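(* Let $n\ge2$ and $m\in\{1,\dots,n-1\}$, and let $P,P'\subset\mathbb{R}^n$ be polytopes containing the origin in their interiors. Suppose $$\widetilde{C}^a_{p,m}(P,\cdot)=\widetilde{C}^a_{p,m}(P',\cdot).$$ Then $P=P'$ when $p>mn$, and $P'$ is a dilate of $P$ when $p=mn$.
   Context: $P'$ is a dilate of $P$ if $P'=\lambda P$ for some $\lambda>0$. $\mathcal{K}^n_{(o)}$ is the set of compact convex sets in $\mathbb{R}^n$ containing the origin in their interior. For $K\in\mathcal{K}^n_{(o)}$: $\rho_K(u)=\max\{t\ge 0: tu\in K\}$; for $\mathcal{H}^{n-1}$-almost every $u\in S^{n-1}$ there is a unique outer unit normal $\nu_K(\rho_K(u)u)$ of $K$ at $\rho_K(u)u$. For Borel $\eta\subset S^{n-1}$, $\boldsymbol{\alpha}_K^*(\eta)$ is the set of $u\in S^{n-1}$ such that some $v\in\eta$ is an outer unit normal of $K$ at $\rho_K(u)u$. $G(n,m)$ is the Grassmannian of $m$-dimensional linear subspaces of $\mathbb{R}^n$, $\omega_j$ is the volume of the unit ball in $\mathbb{R}^j$, and $|L|$ is the $m$-dimensional volume of a set $L$ contained in an $m$-dimensional subspace. The $m$-dimensional dual Radon transform of $F:G(n,m)\to\mathbb{R}$ is $$\mathcal{R}_m^*F(u)=\frac{m\omega_m}{n\omega_n}\int_{G_u(n-1,m-1)}F(\operatorname{span}\{u,\zeta\})\,d\nu_{m-1}(\zeta),\quad u\in S^{n-1},$$ where $G_u(n-1,m-1)$ is the Grassmannian of $(m-1)$-dimensional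 subspaces of $u^\perp$ with Haar probability measure $\nu_{m-1}$. $\mathcal{R}_m^*(|K\cap\cdot|^{n-1})$ is this transform applied to $F(\xi)=|K\cap\xi|^{n-1}$. For $p\in\mathbb{R}$ and Borel $\eta\subset S^{n-1}$, $$\widetilde{C}_{p,m}^a(K,\eta)=\int_{\boldsymbol{\alpha}_K^*(\eta)}\bigl(u\cdot\nu_K(\rho_K(u)u)\bigr)^{-p}\rho_K(u)^{m-p}\,\mathcal{R}_m^*(|K\cap\cdot|^{n-1})(u)\,du,$$ where $du$ is spherical Lebesgue measure. *)

theory Defs
  imports "HOL-Analysis.Analysis" "HOL-Probability.Probability_Measure"
begin

text \<open>
  The image of \<open>n\<close> times Lebesgue measure on the punctured unit ball under
  \<open>x \<mapsto> x / |x|\<close>: by polar coordinates the area of \<open>A\<close> is \<open>n\<close> times the volume of the cone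
  \<open>{t u | 0 < t \<le> 1, u \<in> A}\<close>.  The total mass is \<open>n \<omega>\<^sub>n\<close>.
\<close>

definition spherical_lebesgue :: "(real ^ 'n) measure" where
  "spherical_lebesgue =
     completion (scale_measure (of_nat CARD('n))
       (distr (restrict_space lborel (cball 0 1 - {0}))
              (restrict_space borel (sphere 0 1))
              (\<lambda>x. x /\<^sub>R norm x)))"

definition orthonormal_basis_of :: "(real ^ 'n) set \<Rightarrow> (real ^ 'n) set \<Rightarrow> bool" where
  "orthonormal_basis_of L B \<longleftrightarrow>
     pairwise orthogonal B \<and> (\<forall>b\<in>B. norm b = 1) \<and> span B = L"

text \<open>
  Lebesgue measure of a subspace \<open>L\<close>, transported from coordinates with respect to an orthonormal
  basis of \<open>L\<close>; by rotation invariance it does not depend on the basis chosen.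
\<close>

definition subspace_lborel :: "(real ^ 'n) set \<Rightarrow> (real ^ 'n) measure" where
  "subspace_lborel L =
     (let B = (SOME B. orthonormal_basis_of L B)
      in distr (Pi\<^sub>M B (\<lambda>_. lborel)) borel (\<lambda>c. \<Sum>b\<in>B. c b *\<^sub>R b))"

definition section_volume :: "(real ^ 'n) set \<Rightarrow> (real ^ 'n) set \<Rightarrow> real" where
  "section_volume K L = measure (subspace_lborel L) (K \<inter> L)"

definition grassmannian :: "(real ^ 'n) set \<Rightarrow> nat \<Rightarrow> (real ^ 'n) set set" where
  "grassmannian V k = {L. subspace L \<and> L \<subseteq> V \<and> dim L = k}"

text \<open>
  The Borel sigma-algebra for the usual topology on the Grassmannian, in which a subspace is
  identified with the matrix of the orthogonal projection onto it; \<open>closest_point L\<close> is that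
  projection.
\<close>

definition grassmannian_borel :: "(real ^ 'n) set \<Rightarrow> nat \<Rightarrow> (real ^ 'n) set measure" where
  "grassmannian_borel V k =
     vimage_algebra (grassmannian V k) (\<lambda>L. matrix (closest_point L)) borel"

definition is_haar_probability ::
    "(real ^ 'n) set \<Rightarrow> nat \<Rightarrow> (real ^ 'n) set measure \<Rightarrow> bool" where
  "is_haar_probability V k \<nu> \<longleftrightarrow>
     prob_space \<nu> \<and> sets \<nu> = sets (grassmannian_borel V k) \<and>
     (\<forall>g. orthogonal_transformation g \<and> g ` V = V \<longrightarrow>
        distr \<nu> (grassmannian_borel V k) (\<lambda>L. g ` L) = \<nu>)"

text \<open>
  For a subspace \<open>V\<close> and \<open>k \<le> dim V\<close> such a measure exists and is unique, because the orthogonal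
  group of \<open>V\<close> is compact and acts transitively on the Grassmannian.
\<close>

definition haar_grassmannian :: "(real ^ 'n) set \<Rightarrow> nat \<Rightarrow> (real ^ 'n) set measure" where
  "haar_grassmannian V k = (SOME \<nu>. is_haar_probability V k \<nu>)"

text \<open>
  Only the values of \<open>F\<close> on \<open>m\<close>-dimensional subspaces matter, for \<open>u\<close> in the unit sphere and
  \<open>1 \<le> m\<close>.
\<close>

definition dual_radon ::
    "nat \<Rightarrow> ((real ^ 'n) set \<Rightarrow> real) \<Rightarrow> real ^ 'n \<Rightarrow> real" where
  "dual_radon m F u =
     (real m * unit_ball_vol (real m)) / (real CARD('n) * unit_ball_vol (real CARD('n))) *
     (LINT Z | haar_grassmannian {x. u \<bullet> x = 0} (m - 1). F (span (insert u Z)))"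

definition radial :: "(real ^ 'n) set \<Rightarrow> real ^ 'n \<Rightarrow> real" where
  "radial K u = (GREATEST t. 0 \<le> t \<and> t *\<^sub>R u \<in> K)"

definition is_outer_unit_normal :: "(real ^ 'n) set \<Rightarrow> real ^ 'n \<Rightarrow> real ^ 'n \<Rightarrow> bool" where
  "is_outer_unit_normal K x v \<longleftrightarrow> norm v = 1 \<and> x \<in> K \<and> (\<forall>y\<in>K. v \<bullet> y \<le> v \<bullet> x)"

text \<open>Meaningful only where the outer unit normal is unique, hence almost everywhere.\<close>

definition outer_unit_normal :: "(real ^ 'n) set \<Rightarrow> real ^ 'n \<Rightarrow> real ^ 'n" where
  "outer_unit_normal K x = (THE v. is_outer_unit_normal K x v)"

definition reverse_radial_gauss_image :: "(real ^ 'n) set \<Rightarrow> (real ^ 'n) set \<Rightarrow> (real ^ 'n) set" where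
  "reverse_radial_gauss_image K \<eta> =
     {u \<in> sphere 0 1. \<exists>v\<in>\<eta>. is_outer_unit_normal K (radial K u *\<^sub>R u) v}"

definition affine_dual_curvature ::
    "real \<Rightarrow> nat \<Rightarrow> (real ^ 'n) set \<Rightarrow> (real ^ 'n) set \<Rightarrow> ennreal" where
  "affine_dual_curvature p m K \<eta> =
     (\<integral>\<^sup>+ u \<in> reverse_radial_gauss_image K \<eta>.
        ennreal ((u \<bullet> outer_unit_normal K (radial K u *\<^sub>R u)) powr (- p) *
                 radial K u powr (real m - p) *
                 dual_radon m (\<lambda>L. section_volume K L ^ (CARD('n) - 1)) u)
      \<partial>spherical_lebesgue)"

end

theory Submission
  imports Defs "HOL-Probability.Giry_Monad"
begin

text \<open>
  A polytope with the origin in its interior can be written as \<open>P = {x. \<forall>a\<in>A. a \<bullet> x \<le> 1}\<close> with a minimal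
  finite set \<open>A\<close>: its elements are the facet normals, each divided by its support number. Up to null
  sets, the reverse radial Gauss image of a single direction \<open>v\<close> is empty unless \<open>v = a / |a|\<close> for some
  \<open>a \<in> A\<close>, and then it consists of the directions \<open>u\<close> of the points of that facet. On this set
  \<open>\<rho>(u) = 1 / (a \<bullet> u)\<close> and \<open>u \<bullet> \<nu> = (a \<bullet> u) / |a|\<close>, so the curvature measure has at \<open>a / |a|\<close> the mass
  \<open>|a|\<^sup>p \<integral> (a \<bullet> u)\<^sup>-\<^sup>m R(u) du\<close>, the integral being taken over the directions of the facet and \<open>R\<close> being
  the dual Radon transform of the section function (\<open>affine_dual_curvature_facet\<close>). This mass is
  positive and finite, it is homogeneous of degree \<open>mn - p\<close> in \<open>P\<close>, and it is monotone among polytopes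
  that share the facet hyperplane \<open>{x. a \<bullet> x = 1}\<close>: a larger polytope has a larger facet and larger
  central sections (\<open>affine_dual_curvature_facet_strict_mono\<close>).

  Two polytopes \<open>P\<close>, \<open>P'\<close> with equal curvature measures therefore have the same facet normals. Let \<open>c\<close>
  be maximal with \<open>c P \<subseteq> P'\<close>. Then some facet hyperplane is common to \<open>c P\<close> and \<open>P'\<close>, and comparing the
  masses \<open>W\<close> there gives \<open>c\<^sup>m\<^sup>n\<^sup>-\<^sup>p W \<le> W\<close>. If \<open>p > mn\<close>, this means \<open>c \<ge> 1\<close>, so \<open>P \<subseteq> P'\<close>, and the
  situation is symmetric.

  If \<open>p = mn\<close>, then \<open>c P\<close> and \<open>P'\<close> have the same curvature measure. At each common facet hyperplane
  strictness of the monotonicity forces the facet of \<open>P'\<close> to be contained in \<open>c P\<close>. A facet of \<open>P'\<close> in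
  a common hyperplane cannot meet a facet in another one: at a point that belongs to both, and hence
  to \<open>c P\<close>, the second hyperplane supports \<open>c P\<close> as well, so it would be common. Since the boundary of
  \<open>P'\<close> is connected for \<open>n \<ge> 2\<close>, all facet hyperplanes are common and \<open>P' = c P\<close>.

  About \<open>R\<close> only bounds, monotonicity and homogeneity enter. They follow from those of the section
  volume once the integral over the Grassmannian is known to be one of a bounded measurable function
  against a probability measure. For this an invariant probability measure is constructed on each
  Grassmannian, and the volume of a section is expressed by that of a cylinder over it, which depends
  measurably on the projection matrix. The integrals over the sphere are treated as lower integrals,
  so that arbitrary integrands are admitted.
\<close>

section \<open>Orthogonal projections\<close>

lemma closest_point_subspace_eqI:
  fixes L :: "'a::euclidean_space set"
  assumes L: "subspace L" and "y \<in> L" and orth: "\<And>z. z \<in> L \<Longrightarrow> (x - y) \<bullet> z = 0"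
  shows "closest_point L x = y"
proof -
  have "dist x y \<le> dist x z" if "z \<in> L" for z
  proof -
    have "(x - y) \<bullet> (y - z) = 0"
      using orth that \<open>y \<in> L\<close> L by (simp add: subspace_diff)
    then have "(norm (x - z))\<^sup>2 = (norm (x - y))\<^sup>2 + (norm (y - z))\<^sup>2"
      by (simp add: power2_norm_eq_inner inner_diff_left inner_diff_right inner_commute algebra_simps)
    then have "(norm (x - y))\<^sup>2 \<le> (norm (x - z))\<^sup>2" by simp
    then show ?thesis by (simp add: dist_norm power2_le_iff_abs_le)
  qed
  then show ?thesis
    using closest_point_unique[of L y x] L \<open>y \<in> L\<close> subspace_imp_convex closed_subspace by metis
qed

lemma obtain_orthonormal_basis:
  fixes L :: "'a::euclidean_space set"
  assumes "subspace L"
  obtains B where "pairwise orthogonal B" "\<And>b. b \<in> B \<Longrightarrow> norm b = 1" "finite B" "span B = L" "card B = dim L"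
  using orthonormal_basis_subspace[OF assms] independent_imp_finite by metis

lemma closest_point_subspace_in:
  fixes L :: "'a::euclidean_space set"
  shows "subspace L \<Longrightarrow> closest_point L x \<in> L"
  by (metis closed_subspace closest_point_in_set empty_iff subspace_0)

lemma closest_point_subspace_orthogonal:
  fixes L :: "'a::euclidean_space set"
  assumes "subspace L" "z \<in> L"
  shows "(x - closest_point L x) \<bullet> z = 0"
proof -
  let ?c = "closest_point L x"
  have *: "(x - ?c) \<bullet> w \<le> 0" if "w \<in> L" for w
  proof -
    have "?c + w \<in> L" using assms that by (simp add: closest_point_subspace_in subspace_add)
    from closest_point_dot[OF _ _ this, of x] show ?thesis
      using assms by (simp add: subspace_imp_convex closed_subspace)
  qed
  have "- z \<in> L" using assms by (simp add: subspace_neg)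
  from *[OF this] *[OF assms(2)] show ?thesis by simp
qed

lemma linear_closest_point_subspace:
  fixes L :: "'a::euclidean_space set"
  assumes L: "subspace L"
  shows "linear (closest_point L)"
proof (rule linearI)
  fix x y :: 'a and c :: real
  note in_L = closest_point_subspace_in[OF L] and orth = closest_point_subspace_orthogonal[OF L]
  show "closest_point L (x + y) = closest_point L x + closest_point L y"
    using in_L[of x] in_L[of y] orth[of _ x] orth[of _ y] L
    by (intro closest_point_subspace_eqI)
       (auto simp: subspace_add inner_diff_left inner_add_left)
  show "closest_point L (c *\<^sub>R x) = c *\<^sub>R closest_point L x"
    using in_L[of x] orth[of _ x] L
    by (intro closest_point_subspace_eqI) (auto simp: subspace_scale inner_diff_left)
qed

lemma norm_closest_point_subspace:
  fixes L :: "'a::euclidean_space set"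
  assumes L: "subspace L"
  shows "(norm x)\<^sup>2 = (norm (closest_point L x))\<^sup>2 + (norm (x - closest_point L x))\<^sup>2"
  using closest_point_subspace_orthogonal[OF L closest_point_subspace_in[OF L], of x x]
  by (simp add: power2_norm_eq_inner inner_diff_left inner_diff_right inner_commute)

lemma norm_closest_point_subspace_le:
  fixes L :: "'a::euclidean_space set"
  assumes L: "subspace L"
  shows "norm (closest_point L x) \<le> norm x" "norm (x - closest_point L x) \<le> norm x"
  using norm_closest_point_subspace[OF L, of x] by (simp_all add: power2_le_imp_le)

lemma closest_point_orthogonal_image:
  fixes L :: "'a::euclidean_space set" and g :: "'a \<Rightarrow> 'a"
  assumes g: "orthogonal_transformation g" and L: "subspace L"
  shows "closest_point (g ` L) (g x) = g (closest_point L x)"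
proof -
  have lin: "linear g" using g by (simp add: orthogonal_transformation_linear)
  show ?thesis
  proof (rule closest_point_subspace_eqI)
    show "subspace (g ` L)" using lin L by (rule linear_subspace_image)
    show "g (closest_point L x) \<in> g ` L" using closest_point_subspace_in[OF L] by blast
    fix z assume "z \<in> g ` L"
    then obtain w where "w \<in> L" "z = g w" by blast
    have "(g x - g (closest_point L x)) \<bullet> z = g (x - closest_point L x) \<bullet> g w"
      using lin \<open>z = g w\<close> by (simp add: linear_diff)
    also have "\<dots> = (x - closest_point L x) \<bullet> w"
      using g unfolding orthogonal_transformation_def by blast
    finally show "(g x - g (closest_point L x)) \<bullet> z = 0"
      using closest_point_subspace_orthogonal[OF L \<open>w \<in> L\<close>] by simp
  qed
qed

lemma closest_point_span_insert:
  fixes L :: "'a::euclidean_space set"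
  assumes L: "subspace L" and y: "y \<noteq> 0" and orth: "\<And>z. z \<in> L \<Longrightarrow> y \<bullet> z = 0"
  shows "closest_point (span (insert y L)) x = closest_point L x + ((y \<bullet> x) / (y \<bullet> y)) *\<^sub>R y"
proof (rule closest_point_subspace_eqI)
  let ?c = "closest_point L x + ((y \<bullet> x) / (y \<bullet> y)) *\<^sub>R y"
  have cL: "closest_point L x \<in> L" by (rule closest_point_subspace_in[OF L])
  then show "?c \<in> span (insert y L)"
    by (intro span_add span_scale) (auto intro: span_base)
  fix z assume "z \<in> span (insert y L)"
  then obtain k w where z: "z = k *\<^sub>R y + w" "w \<in> L"
    using L by (metis add.commute diff_eq_eq span_breakdown_eq span_eq_iff)
  have "(x - ?c) \<bullet> y = 0"
    using y orth[OF cL] inner_commute[of y "closest_point L x"] inner_commute[of x y]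
    by (simp add: inner_diff_left inner_add_left)
  moreover have "(x - ?c) \<bullet> w = 0"
    using closest_point_subspace_orthogonal[OF L z(2), of x] orth[OF z(2)]
    by (simp add: inner_diff_left inner_add_left)
  ultimately show "(x - ?c) \<bullet> z = 0" using z by (simp add: inner_right_distrib)
qed simp

section \<open>Rotation invariance\<close>

lemma lborel_distr_minus: "distr lborel borel (\<lambda>x. y - x) = (lborel :: 'a::euclidean_space measure)"
  by (subst (2) lborel_affine[of "-1" y]) (auto simp: density_1)

text \<open>
  The standard uniqueness argument for translation-invariant measures. Put \<open>M\<close> for the image of
  Lebesgue measure \<open>\<lambda>\<close> under \<open>g\<close>. Integrating \<open>1\<^sub>A(x) 1\<^sub>B(y - x)\<close> over \<open>\<lambda> \<otimes> M\<close> gives \<open>\<lambda>(A) M(B)\<close>, and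
  substituting \<open>x \<mapsto> y - x\<close> exchanges the roles of \<open>A\<close> and \<open>B\<close>. Taking for \<open>B\<close> the unit ball, which \<open>g\<close>
  preserves, shows \<open>M = \<lambda>\<close>.
\<close>

lemma lborel_orthogonal_transformation:
  fixes g :: "'a::euclidean_space \<Rightarrow> 'a"
  assumes g: "orthogonal_transformation g"
  shows "distr lborel borel g = lborel"
proof (rule measure_eqI)
  have lin: "linear g" using g by (simp add: orthogonal_transformation_linear)
  have g_meas[measurable]: "g \<in> borel_measurable borel"
    using lin by (intro borel_measurable_continuous_onI linear_continuous_on linear_linear[THEN iffD2])
  define M where "M = distr lborel borel g"
  have sM[measurable_cong]: "sets M = sets borel" by (simp add: M_def)
  obtain h where h: "\<And>x. g (h x) = x"
    using orthogonal_transformation_surj[OF g] by (metis surjD)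
  have M_cball: "emeasure M (cball 0 r) = emeasure lborel (cball 0 r :: 'a set)" for r
  proof -
    have "g -` cball 0 r = cball 0 r"
      using g by (auto simp: orthogonal_transformation_norm)
    then show ?thesis unfolding M_def by (subst emeasure_distr) auto
  qed
  interpret M: sigma_finite_measure M
  proof
    have "(\<Union>n. cball (0::'a) (real n)) = UNIV"
      using real_arch_simple by (auto simp: set_eq_iff)
    then show "\<exists>A. countable A \<and> A \<subseteq> sets M \<and> \<Union>A = space M \<and> (\<forall>a\<in>A. emeasure M a \<noteq> \<infinity>)"
      using M_cball emeasure_lborel_cball_finite
      by (intro exI[of _ "range (\<lambda>n. cball 0 (real n))"]) (auto simp: sM M_def less_top[symmetric])
  qed
  interpret pair_sigma_finite lborel M ..
  \<comment> \<open>\<open>M\<close> inherits translation invariance, because translation by \<open>x\<close> comes from translation by \<open>h x\<close>.\<close>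
  have shift: "emeasure M ((\<lambda>y. y - x) -` B) = emeasure M B" if B[measurable]: "B \<in> sets borel" for x B
  proof -
    have "emeasure M ((\<lambda>y. y - x) -` B) = emeasure lborel ((\<lambda>z. g z - x) -` B)"
      unfolding M_def by (subst emeasure_distr) (auto simp: vimage_def)
    also have "(\<lambda>z. g z - x) -` B = (+) (- h x) -` (g -` B)"
      using lin h by (auto simp: linear_diff)
    also have "emeasure lborel \<dots> = emeasure (distr lborel borel ((+) (- h x))) (g -` B)"
      using measurable_sets[OF g_meas, of B] by (subst emeasure_distr) auto
    also have "\<dots> = emeasure M B"
      unfolding lborel_distr_plus M_def by (simp add: emeasure_distr)
    finally show ?thesis .
  qed
  \<comment> \<open>Both sides are the integral of \<open>1\<^sub>A(x) 1\<^sub>B(y - x)\<close> over the product measure.\<close>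
  have swap: "emeasure lborel A * emeasure M B = emeasure lborel B * emeasure M A"
    if A[measurable]: "A \<in> sets borel" and B[measurable]: "B \<in> sets borel" for A B
  proof -
    have conv: "(\<integral>\<^sup>+x. \<integral>\<^sup>+y. indicator C x * indicator D (y - x) \<partial>M \<partial>lborel) = emeasure lborel C * emeasure M D"
      if [measurable]: "C \<in> sets borel" "D \<in> sets borel" for C D
    proof -
      have "(\<integral>\<^sup>+y. indicator C x * indicator D (y - x) \<partial>M) = indicator C x * emeasure M D" for x
      proof -
        have "(\<integral>\<^sup>+y. indicator D (y - x) \<partial>M) = (\<integral>\<^sup>+y. indicator ((\<lambda>y. y - x) -` D) y \<partial>M)"
          by (simp add: indicator_def vimage_def)
        also have "\<dots> = emeasure M D"
          using shift[of D x] measurable_sets[of "\<lambda>y. y - x" borel borel D]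
          by (subst nn_integral_indicator) (auto simp: sM)
        finally show ?thesis by (subst nn_integral_cmult) (auto simp: sM)
      qed
      then show ?thesis by (simp add: nn_integral_multc)
    qed
    have "emeasure lborel A * emeasure M B = (\<integral>\<^sup>+x. \<integral>\<^sup>+y. indicator A x * indicator B (y - x) \<partial>M \<partial>lborel)"
      by (simp add: conv)
    also have "\<dots> = (\<integral>\<^sup>+y. \<integral>\<^sup>+x. indicator A x * indicator B (y - x) \<partial>lborel \<partial>M)"
      by (subst Fubini') auto
    also have "\<dots> = (\<integral>\<^sup>+y. \<integral>\<^sup>+x. indicator B x * indicator A (y - x) \<partial>lborel \<partial>M)"
    proof (rule nn_integral_cong)
      fix y
      have "(\<integral>\<^sup>+x. indicator A x * indicator B (y - x) \<partial>lborel)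
          = (\<integral>\<^sup>+x. indicator A x * indicator B (y - x) \<partial>distr lborel borel (\<lambda>x. y - x))"
        by (subst lborel_distr_minus) (rule refl)
      also have "\<dots> = (\<integral>\<^sup>+x. indicator A (y - x) * indicator B (y - (y - x)) \<partial>lborel)"
        by (rule nn_integral_distr) auto
      finally show "(\<integral>\<^sup>+x. indicator A x * indicator B (y - x) \<partial>lborel)
          = (\<integral>\<^sup>+x. indicator B x * indicator A (y - x) \<partial>lborel :: ennreal)"
        by (simp add: ac_simps)
    qed
    also have "\<dots> = (\<integral>\<^sup>+x. \<integral>\<^sup>+y. indicator B x * indicator A (y - x) \<partial>M \<partial>lborel)"
      by (subst Fubini') auto
    finally show ?thesis by (simp add: conv)
  qed
  fix A assume "A \<in> sets (distr lborel borel g)"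
  then have A: "A \<in> sets borel" by simp
  have fin: "emeasure lborel (cball 0 1 :: 'a set) \<noteq> \<infinity>"
    using emeasure_lborel_cball_finite by (simp add: less_top)
  have pos: "emeasure lborel (cball 0 1 :: 'a set) \<noteq> 0"
    by (simp add: emeasure_cball unit_ball_vol_pos less_imp_neq[symmetric])
  have "emeasure lborel (cball 0 1 :: 'a set) * emeasure lborel A = emeasure lborel (cball 0 1 :: 'a set) * emeasure M A"
    using swap[OF A, of "cball 0 1"] M_cball by (simp add: mult.commute)
  then show "emeasure (distr lborel borel g) A = emeasure lborel A"
    using fin pos by (simp add: ennreal_mult_cancel_left M_def)
qed simp

section \<open>The volume of a central section\<close>

lemma distr_PiM_bij_betw:
  assumes N: "sigma_finite_measure N" and bij: "bij_betw \<beta> I J" and fin: "finite I"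
  shows "distr (Pi\<^sub>M J (\<lambda>_. N)) (Pi\<^sub>M I (\<lambda>_. N)) (\<lambda>c. \<lambda>i\<in>I. c (\<beta> i)) = Pi\<^sub>M I (\<lambda>_. N)"
proof -
  interpret N: sigma_finite_measure N by (rule N)
  interpret I: product_sigma_finite "\<lambda>_. N" ..
  have finJ: "finite J" using bij fin bij_betw_finite by blast
  interpret J: finite_product_sigma_finite "\<lambda>_. N" J by standard (rule finJ)
  have inJ: "\<beta> i \<in> J" if "i \<in> I" for i using bij that by (auto simp: bij_betw_def)
  have [measurable]: "(\<lambda>c. \<lambda>i\<in>I. c (\<beta> i)) \<in> Pi\<^sub>M J (\<lambda>_. N) \<rightarrow>\<^sub>M Pi\<^sub>M I (\<lambda>_. N)"
    using inJ by (intro measurable_restrict measurable_component_singleton)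
  show ?thesis
  proof (rule I.PiM_eqI[OF fin])
    fix A assume A: "\<And>i. i \<in> I \<Longrightarrow> A i \<in> sets N"
    define \<gamma> where "\<gamma> = the_inv_into I \<beta>"
    have g: "\<gamma> (\<beta> i) = i" if "i \<in> I" for i
      using bij that unfolding \<gamma>_def by (simp add: bij_betw_def the_inv_into_f_f)
    have g': "\<gamma> j \<in> I" "\<beta> (\<gamma> j) = j" if "j \<in> J" for j
      using bij that g by (auto simp: bij_betw_def)
    have pre: "(\<lambda>c. \<lambda>i\<in>I. c (\<beta> i)) -` Pi\<^sub>E I A \<inter> space (Pi\<^sub>M J (\<lambda>_. N)) = Pi\<^sub>E J (\<lambda>j. A (\<gamma> j))"
      using A[THEN sets.sets_into_space] g g' inJ
      by (auto simp: space_PiM PiE_iff subset_eq) metis+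
    have "emeasure (distr (Pi\<^sub>M J (\<lambda>_. N)) (Pi\<^sub>M I (\<lambda>_. N)) (\<lambda>c. \<lambda>i\<in>I. c (\<beta> i))) (Pi\<^sub>E I A)
        = emeasure (Pi\<^sub>M J (\<lambda>_. N)) (Pi\<^sub>E J (\<lambda>j. A (\<gamma> j)))"
      using A fin pre by (subst emeasure_distr) auto
    also have "\<dots> = (\<Prod>j\<in>J. emeasure N (A (\<gamma> j)))"
      using A g' by (intro J.measure_times) auto
    also have "\<dots> = (\<Prod>i\<in>I. emeasure N (A i))"
      using g by (subst prod.reindex_bij_betw[OF bij, symmetric]) (auto intro!: prod.cong)
    finally show "emeasure (distr (Pi\<^sub>M J (\<lambda>_. N)) (Pi\<^sub>M I (\<lambda>_. N)) (\<lambda>c. \<lambda>i\<in>I. c (\<beta> i))) (Pi\<^sub>E I A)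
      = (\<Prod>i\<in>I. emeasure N (A i))" .
  qed simp
qed

text \<open>
  Rotation invariance turns the coordinates of the standard basis into those of any other
  orthonormal basis.
\<close>

lemma lborel_orthonormal_coordinates:
  fixes U :: "'a::euclidean_space set"
  assumes U: "pairwise orthogonal U" "\<And>b. b \<in> U \<Longrightarrow> norm b = 1" "finite U" and span: "span U = UNIV"
  shows "distr (Pi\<^sub>M U (\<lambda>_. lborel)) borel (\<lambda>c. \<Sum>b\<in>U. c b *\<^sub>R b) = lborel"
proof -
  interpret product_sigma_finite "\<lambda>_::'a. lborel :: real measure" ..
  have "independent U"
    using U by (intro pairwise_orthogonal_independent) force+
  then have "card U = card (Basis :: 'a set)"
    using span by (metis dim_UNIV dim_span dim_eq_card_independent)
  then obtain \<beta> where bij: "bij_betw \<beta> (Basis :: 'a set) U"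
    using U(3) by (metis finite_Basis finite_same_card_bij)
  have inU: "\<beta> i \<in> U" if "i \<in> Basis" for i using bij that by (auto simp: bij_betw_def)
  define g where "g x = (\<Sum>i\<in>Basis. (x \<bullet> i) *\<^sub>R \<beta> i)" for x :: 'a
  have lin: "linear g"
    by (auto intro!: linearI simp: g_def inner_add_left scaleR_add_left sum.distrib scaleR_sum_right)
  have ortho: "\<beta> i \<bullet> \<beta> j = (if i = j then 1 else 0)" if "i \<in> Basis" "j \<in> Basis" for i j
    using U(1) U(2)[OF inU[OF that(1)]] inU[OF that(1)] inU[OF that(2)] that bij
    by (auto simp: pairwise_def orthogonal_def bij_betw_def inj_on_eq_iff norm_eq_1)
  have "g x \<bullet> g y = x \<bullet> y" for x y
  proof -
    have "g x \<bullet> g y = (\<Sum>i\<in>Basis. \<Sum>j\<in>Basis. if i = j then (x \<bullet> i) * (y \<bullet> j) else 0)"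
      unfolding g_def inner_sum_left inner_sum_right by (intro sum.cong refl) (auto simp: ortho)
    then show ?thesis by (simp add: euclidean_inner[of x y])
  qed
  then have g: "orthogonal_transformation g" using lin by (simp add: orthogonal_transformation_def)
  have [measurable]: "g \<in> borel_measurable borel" unfolding g_def by measurable
  have "lborel = distr lborel borel g" using lborel_orthogonal_transformation[OF g] by simp
  also have "\<dots> = distr (distr (\<Pi>\<^sub>M b\<in>Basis. lborel) borel (\<lambda>f. \<Sum>b\<in>Basis. f b *\<^sub>R b)) borel g"
    by (subst lborel_eq) simp
  also have "\<dots> = distr (\<Pi>\<^sub>M b\<in>Basis. lborel) borel (\<lambda>f. \<Sum>b\<in>Basis. f b *\<^sub>R \<beta> b)"
    by (subst distr_distr) (auto simp: g_def comp_def inner_sum_left inner_Basis if_distrib cong: if_cong intro!: distr_cong)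
  also have "\<dots> = distr (distr (Pi\<^sub>M U (\<lambda>_. lborel)) (Pi\<^sub>M Basis (\<lambda>_. lborel)) (\<lambda>c. \<lambda>i\<in>Basis. c (\<beta> i))) borel (\<lambda>f. \<Sum>b\<in>Basis. f b *\<^sub>R \<beta> b)"
    by (subst distr_PiM_bij_betw[OF lborel.sigma_finite_measure_axioms bij]) auto
  also have "\<dots> = distr (Pi\<^sub>M U (\<lambda>_. lborel)) borel (\<lambda>c. \<Sum>b\<in>Basis. c (\<beta> b) *\<^sub>R \<beta> b)"
    using inU by (subst distr_distr) (auto simp: comp_def intro!: distr_cong measurable_restrict measurable_component_singleton)
  also have "(\<lambda>c. \<Sum>b\<in>Basis. c (\<beta> b) *\<^sub>R \<beta> b) = (\<lambda>c. \<Sum>b\<in>U. c b *\<^sub>R b)"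
    by (rule ext) (rule sum.reindex_bij_betw[OF bij])
  finally show ?thesis by simp
qed

lemma borel_measurable_closest_point_subspace [measurable]:
  fixes L :: "'a::euclidean_space set"
  shows "subspace L \<Longrightarrow> closest_point L \<in> borel_measurable borel"
  using linear_closest_point_subspace
  by (intro borel_measurable_continuous_onI linear_continuous_on linear_linear[THEN iffD2])

text \<open>
  Fubini in an orthonormal basis adapted to \<open>L\<close> and its orthogonal complement: the cylinder is the
  product of \<open>K \<inter> L\<close> and a ball of radius \<open>t\<close> in the complement. The right-hand side thereby becomes
  accessible through Lebesgue measure of the whole space and the orthogonal projection onto \<open>L\<close>, in
  terms of which the Borel structure of the Grassmannian is defined.
\<close>

lemma emeasure_cylinder_over_section:
  fixes K L :: "(real ^ 'n) set"
  assumes L: "subspace L" and K: "K \<in> sets borel" and t: "t > 0"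
  shows "emeasure lborel {x. closest_point L x \<in> K \<and> norm (x - closest_point L x) \<le> t}
    = emeasure (subspace_lborel L) (K \<inter> L) * ennreal (unit_ball_vol (CARD('n) - dim L) * t ^ (CARD('n) - dim L))"
proof -
  define B where "B = (SOME B. orthonormal_basis_of L B)"
  have "\<exists>B. orthonormal_basis_of L B"
    using obtain_orthonormal_basis[OF L] unfolding orthonormal_basis_of_def by metis
  then have "orthonormal_basis_of L B" unfolding B_def by (rule someI_ex)
  then have B: "pairwise orthogonal B" "\<And>b. b \<in> B \<Longrightarrow> norm b = 1" "span B = L"
    by (auto simp: orthonormal_basis_of_def)
  have "independent B" using B by (intro pairwise_orthogonal_independent) force+
  then have finB: "finite B" by (rule independent_imp_finite)
  obtain C where C: "pairwise orthogonal C" "\<And>b. b \<in> C \<Longrightarrow> norm b = 1" "finite C" "span C = L\<^sup>\<bottom>" "card C = dim (L\<^sup>\<bottom>)"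
    using obtain_orthonormal_basis[OF subspace_orthogonal_comp] by metis
  have "dim {y \<in> UNIV. \<forall>x\<in>L. orthogonal x y} + dim L = dim (UNIV :: (real^'n) set)"
    using L by (intro dim_subspace_orthogonal_to_vectors) auto
  then have cardC: "card C = CARD('n) - dim L"
    by (simp add: C(5) orthogonal_comp_def dim_UNIV)
  have BC: "b \<bullet> c = 0" if "b \<in> B" "c \<in> C" for b c
  proof -
    have "b \<in> L" "c \<in> L\<^sup>\<bottom>" using that B(3) C(4) span_base by blast+
    then show ?thesis by (auto simp: orthogonal_comp_def orthogonal_def)
  qed
  have disj: "B \<inter> C = {}"
  proof -
    have False if "b \<in> B" "b \<in> C" for b using BC[OF that] B(2)[OF that(1)] by (simp add: norm_eq_1)
    then show ?thesis by blast
  qed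
  have "pairwise orthogonal (B \<union> C)"
    using B(1) C(1) BC BC[THEN trans[OF inner_commute]] unfolding pairwise_def orthogonal_def by auto
  moreover have "span (B \<union> C) = UNIV"
  proof -
    have "x \<in> span (B \<union> C)" for x
    proof -
      have "closest_point L x \<in> span B" using closest_point_subspace_in[OF L] B(3) by simp
      moreover have "x - closest_point L x \<in> span C"
        using closest_point_subspace_orthogonal[OF L, of _ x] C(4)
        by (auto simp: orthogonal_comp_def orthogonal_def inner_commute)
      ultimately have "closest_point L x + (x - closest_point L x) \<in> span (B \<union> C)"
        by (meson span_add span_mono subsetD sup_ge1 sup_ge2)
      then show ?thesis by simp
    qed
    then show ?thesis by blast
  qed
  ultimately have U: "distr (Pi\<^sub>M (B \<union> C) (\<lambda>_. lborel)) borel (\<lambda>c. \<Sum>b\<in>B\<union>C. c b *\<^sub>R b) = lborel"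
    using B(2) C(2) finB C(3) by (intro lborel_orthonormal_coordinates) auto
  interpret product_sigma_finite "\<lambda>_::real^'n. lborel :: real measure" ..
  interpret Bf: finite_product_sigma_finite "\<lambda>_::real^'n. lborel :: real measure" B by standard (rule finB)
  interpret Cf: finite_product_sigma_finite "\<lambda>_::real^'n. lborel :: real measure" C by standard (rule C(3))
  let ?MB = "Pi\<^sub>M B (\<lambda>_. lborel :: real measure)" and ?MC = "Pi\<^sub>M C (\<lambda>_. lborel :: real measure)"
  let ?S = "{x. closest_point L x \<in> K \<and> norm (x - closest_point L x) \<le> t}"
  let ?X = "{c \<in> space ?MB. (\<Sum>b\<in>B. c b *\<^sub>R b) \<in> K}"
  let ?Y = "{d. sqrt (\<Sum>b\<in>C. (d b)\<^sup>2) \<le> t} \<inter> space ?MC"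
  have K'[measurable]: "K \<in> sets borel" by (rule K)
  note borel_measurable_closest_point_subspace[OF L, measurable]
  have S: "?S \<in> sets borel"
    by measurable
  have T: "(\<Sum>b\<in>B\<union>C. merge B C (c, d) b *\<^sub>R b) = (\<Sum>b\<in>B. c b *\<^sub>R b) + (\<Sum>b\<in>C. d b *\<^sub>R b)" for c d
    using disj finB C(3) by (subst sum.union_disjoint) (auto simp: merge_def intro!: arg_cong2[where f="(+)"] sum.cong)
  have proj: "closest_point L ((\<Sum>b\<in>B. c b *\<^sub>R b) + (\<Sum>b\<in>C. d b *\<^sub>R b)) = (\<Sum>b\<in>B. c b *\<^sub>R b)" for c d
  proof (rule closest_point_subspace_eqI[OF L])
    show "(\<Sum>b\<in>B. c b *\<^sub>R b) \<in> L" unfolding B(3)[symmetric] by (intro span_sum span_scale span_base)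
    fix z assume z: "z \<in> L"
    have "(\<Sum>b\<in>C. d b *\<^sub>R b) \<in> L\<^sup>\<bottom>" unfolding C(4)[symmetric] by (intro span_sum span_scale span_base)
    then show "((\<Sum>b\<in>B. c b *\<^sub>R b) + (\<Sum>b\<in>C. d b *\<^sub>R b) - (\<Sum>b\<in>B. c b *\<^sub>R b)) \<bullet> z = 0"
      using z by (auto simp: orthogonal_comp_def orthogonal_def inner_commute)
  qed
  have normC: "norm (\<Sum>b\<in>C. d b *\<^sub>R b) = sqrt (\<Sum>b\<in>C. (d b)\<^sup>2)" for d
  proof -
    have "(norm (\<Sum>b\<in>C. d b *\<^sub>R b))\<^sup>2 = (\<Sum>b\<in>C. (norm (d b *\<^sub>R b))\<^sup>2)"
      using C(1,3) by (intro norm_sum_Pythagorean) (auto simp: pairwise_def orthogonal_def)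
    also have "\<dots> = (\<Sum>b\<in>C. (d b)\<^sup>2)" by (intro sum.cong) (auto simp: C(2))
    finally have "sqrt ((norm (\<Sum>b\<in>C. d b *\<^sub>R b))\<^sup>2) = sqrt (\<Sum>b\<in>C. (d b)\<^sup>2)" by (rule arg_cong)
    then show ?thesis by (simp only: real_sqrt_abs abs_norm_cancel)
  qed
  have X: "?X \<in> sets ?MB" by measurable
  have Y: "?Y \<in> sets ?MC" 
    by measurable
  have "emeasure lborel ?S = emeasure (distr (Pi\<^sub>M (B \<union> C) (\<lambda>_. lborel)) borel (\<lambda>c. \<Sum>b\<in>B\<union>C. c b *\<^sub>R b)) ?S"
    by (simp add: U)
  also have "\<dots> = emeasure (distr (distr (?MB \<Otimes>\<^sub>M ?MC) (Pi\<^sub>M (B \<union> C) (\<lambda>_. lborel)) (merge B C)) borel (\<lambda>c. \<Sum>b\<in>B\<union>C. c b *\<^sub>R b)) ?S"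
    by (simp add: distr_merge[OF disj finB C(3)])
  also have "\<dots> = emeasure (?MB \<Otimes>\<^sub>M ?MC) ((\<lambda>cd. \<Sum>b\<in>B\<union>C. merge B C cd b *\<^sub>R b) -` ?S \<inter> space (?MB \<Otimes>\<^sub>M ?MC))"
    using S by (subst distr_distr) (auto simp: emeasure_distr comp_def)
  also have "(\<lambda>cd. \<Sum>b\<in>B\<union>C. merge B C cd b *\<^sub>R b) -` ?S \<inter> space (?MB \<Otimes>\<^sub>M ?MC) = ?X \<times> ?Y"
    by (auto simp: space_pair_measure T proj normC)
  also have "emeasure (?MB \<Otimes>\<^sub>M ?MC) (?X \<times> ?Y) = emeasure ?MB ?X * emeasure ?MC ?Y"
    using X Y by (rule Cf.emeasure_pair_measure_Times)
  also have "emeasure ?MC ?Y = ennreal (unit_ball_vol (CARD('n) - dim L) * t ^ (CARD('n) - dim L))"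
    using emeasure_cball_aux[OF C(3) t] by (simp add: cardC)
  also have "emeasure ?MB ?X = emeasure (subspace_lborel L) (K \<inter> L)"
  proof -
    have "(\<Sum>b\<in>B. c b *\<^sub>R b) \<in> L" for c
      unfolding B(3)[symmetric] by (intro span_sum span_scale span_base)
    then have "?X = (\<lambda>c. \<Sum>b\<in>B. c b *\<^sub>R b) -` (K \<inter> L) \<inter> space ?MB"
      by auto
    moreover have "closed L" using L by (rule closed_subspace)
    ultimately show ?thesis
      unfolding subspace_lborel_def B_def[symmetric] Let_def
      by (subst emeasure_distr) auto
  qed
  finally show ?thesis .
qed

lemma section_volume_cylinder:
  fixes K L :: "(real ^ 'n) set"
  assumes "subspace L" "K \<in> sets borel" "t > 0"
  shows "section_volume K L * (unit_ball_vol (CARD('n) - dim L) * t ^ (CARD('n) - dim L))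
    = measure lborel {x. closest_point L x \<in> K \<and> norm (x - closest_point L x) \<le> t}"
  using assms unfolding section_volume_def measure_def
  by (subst emeasure_cylinder_over_section) (auto simp: enn2real_mult)

lemma section_volume_eq:
  fixes K L :: "(real ^ 'n) set"
  assumes "subspace L" "K \<in> sets borel"
  shows "section_volume K L = measure lborel {x. closest_point L x \<in> K \<and> norm (x - closest_point L x) \<le> 1}
    / unit_ball_vol (CARD('n) - dim L)"
proof -
  have "unit_ball_vol (real (CARD('n) - dim L)) \<noteq> 0" by (rule less_imp_neq[symmetric]) simp
  then show ?thesis using section_volume_cylinder[OF assms, of 1] by (simp add: eq_divide_eq)
qed

text \<open>
  The cylinder of radius \<open>c\<close> over \<open>c K\<close> is the dilate by \<open>c\<close> of the cylinder of radius \<open>1\<close> over \<open>K\<close>;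
  dividing \<open>c ^ n\<close> by the factor \<open>c ^ (n - dim L)\<close> of the ball in the complement leaves \<open>c ^ dim L\<close>.
\<close>

lemma section_volume_scale:
  fixes K L :: "(real ^ 'n) set"
  assumes L: "subspace L" and K: "K \<in> sets borel" and c: "c > 0"
  shows "section_volume ((*\<^sub>R) c ` K) L = c ^ dim L * section_volume K L"
proof -
  let ?d = "CARD('n) - dim L"
  let ?cyl = "\<lambda>K t. {x. closest_point L x \<in> K \<and> norm (x - closest_point L x) \<le> t}"
  note lin = linear_closest_point_subspace[OF L]
  have cK: "(*\<^sub>R) c ` K \<in> sets borel"
  proof -
    have "(*\<^sub>R) c ` K = (\<lambda>x. x /\<^sub>R c) -` K"
      using c by (auto simp: image_iff intro!: bexI[of _ "_ /\<^sub>R c"])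
    then show ?thesis using measurable_sets[of "\<lambda>x. x /\<^sub>R c" borel borel K] K by simp
  qed
  have cyl: "?cyl ((*\<^sub>R) c ` K) c = (*\<^sub>R) c ` ?cyl K 1"
  proof (rule set_eqI)
    fix x
    have eq: "closest_point L (x /\<^sub>R c) = closest_point L x /\<^sub>R c" using lin by (simp add: linear_cmul)
    have "closest_point L x \<in> (*\<^sub>R) c ` K \<longleftrightarrow> closest_point L (x /\<^sub>R c) \<in> K"
      unfolding eq using c by (auto simp: image_iff intro!: bexI[of _ "_ /\<^sub>R c"])
    moreover have "norm (x - closest_point L x) \<le> c \<longleftrightarrow> norm (x /\<^sub>R c - closest_point L (x /\<^sub>R c)) \<le> 1"
      unfolding eq scaleR_diff_right[symmetric] using c by (simp add: inverse_eq_divide pos_divide_le_eq del: scaleR_diff_right)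
    ultimately show "x \<in> ?cyl ((*\<^sub>R) c ` K) c \<longleftrightarrow> x \<in> (*\<^sub>R) c ` ?cyl K 1"
      using c by (auto simp: image_iff intro!: exI[of _ "x /\<^sub>R c"])
  qed
  note borel_measurable_closest_point_subspace[OF L, measurable]
  have [measurable]: "K \<in> sets borel" by (rule K)
  have S: "?cyl K 1 \<in> sets borel" by measurable
  have cS: "(*\<^sub>R) c ` ?cyl K 1 \<in> sets borel" unfolding cyl[symmetric] using cK by measurable
  have d: "dim L \<le> CARD('n)" using dim_subset_UNIV[of L] by (simp add: dim_UNIV)
  have "section_volume ((*\<^sub>R) c ` K) L * (unit_ball_vol ?d * c ^ ?d) = measure lborel ((*\<^sub>R) c ` ?cyl K 1)"
    using section_volume_cylinder[OF L cK c] cyl by simp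
  also have "\<dots> = measure lebesgue ((*\<^sub>R) c ` ?cyl K 1)" using cS by simp
  also have "\<dots> = c ^ CARD('n) * measure lborel (?cyl K 1)"
    using S c measure_lebesgue_affine[of c 0 "?cyl K 1"] by simp
  also have "\<dots> = c ^ (?d + dim L) * (section_volume K L * unit_ball_vol ?d)"
    using section_volume_cylinder[OF L K, of 1] d by simp
  finally have "unit_ball_vol ?d * (c ^ ?d * section_volume ((*\<^sub>R) c ` K) L)
      = unit_ball_vol ?d * (c ^ ?d * (c ^ dim L * section_volume K L))"
    by (simp only: power_add mult_ac)
  moreover have "unit_ball_vol ?d \<noteq> 0" by (rule less_imp_neq[symmetric]) simp
  ultimately show ?thesis using c by simp
qed

lemma cylinder_subset_cball:
  fixes K L :: "(real ^ 'n) set"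
  assumes "K \<subseteq> cball 0 R"
  shows "{x. closest_point L x \<in> K \<and> norm (x - closest_point L x) \<le> 1} \<subseteq> cball 0 (R + 1)"
proof
  fix x assume x: "x \<in> {x. closest_point L x \<in> K \<and> norm (x - closest_point L x) \<le> 1}"
  then have "norm (closest_point L x) \<le> R" using assms by auto
  moreover have "norm x \<le> norm (closest_point L x) + norm (x - closest_point L x)"
    using norm_triangle_ineq[of "closest_point L x" "x - closest_point L x"] by simp
  ultimately show "x \<in> cball 0 (R + 1)" using x by auto
qed

lemma cylinder_fmeasurable:
  fixes K L :: "(real ^ 'n) set"
  assumes L: "subspace L" and K: "compact K"
  shows "{x. closest_point L x \<in> K \<and> norm (x - closest_point L x) \<le> 1} \<in> fmeasurable lborel"
proof -
  obtain R where R: "K \<subseteq> cball 0 R"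
    using compact_imp_bounded[OF K] bounded_iff[of K] by (force simp: subset_eq)
  note [measurable] = borel_measurable_closest_point_subspace[OF L] borel_compact[OF K]
  have "cball 0 (R + 1) \<in> fmeasurable (lborel :: (real^'n) measure)"
    using emeasure_lborel_cball_finite by (intro fmeasurableI) auto
  moreover have "{x. closest_point L x \<in> K \<and> norm (x - closest_point L x) \<le> 1} \<in> sets borel" by measurable
  ultimately show ?thesis
    using cylinder_subset_cball[OF R, of L] by (auto intro: fmeasurableI2)
qed

lemma section_volume_mono:
  fixes K K' L :: "(real ^ 'n) set"
  assumes L: "subspace L" and "compact K" "compact K'" "K \<subseteq> K'"
  shows "section_volume K L \<le> section_volume K' L"
proof -
  have b: "K \<in> sets borel" "K' \<in> sets borel" using assms by (simp_all add: borel_compact)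
  note [measurable] = borel_measurable_closest_point_subspace[OF L] b
  let ?cyl = "\<lambda>K. {x. closest_point L x \<in> K \<and> norm (x - closest_point L x) \<le> 1}"
  have "measure lborel (?cyl K) \<le> measure lborel (?cyl K')"
  proof (rule measure_mono_fmeasurable)
    show "?cyl K' \<in> fmeasurable lborel" by (rule cylinder_fmeasurable) fact+
    show "?cyl K \<in> sets lborel" by (simp, measurable)
  qed (use assms in auto)
  then show ?thesis
    using unit_ball_vol_pos[of "real (CARD('n) - dim L)"] by (simp add: section_volume_eq L b divide_right_mono)
qed

text \<open>
  The bounds do not depend on \<open>L\<close>: orthogonal projections are contractions, so the cylinder over the
  section contains a ball around the origin and is contained in another one.
\<close>

lemma section_volume_cball_bounds:
  fixes K L :: "(real ^ 'n) set"
  assumes L: "subspace L" and K: "compact K"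
  shows section_volume_ge: "cball 0 r \<subseteq> K \<Longrightarrow>
      measure lborel (cball 0 (min r 1) :: (real ^ 'n) set) / unit_ball_vol (CARD('n) - dim L) \<le> section_volume K L"
    and section_volume_le: "K \<subseteq> cball 0 R \<Longrightarrow>
      section_volume K L \<le> measure lborel (cball 0 (R + 1) :: (real ^ 'n) set) / unit_ball_vol (CARD('n) - dim L)"
proof -
  have b: "K \<in> sets borel" using K by (simp add: borel_compact)
  note [measurable] = borel_measurable_closest_point_subspace[OF L] b
  let ?cyl = "{x. closest_point L x \<in> K \<and> norm (x - closest_point L x) \<le> 1}"
  have cyl: "?cyl \<in> sets lborel" by (simp, measurable)
  have pos: "unit_ball_vol (CARD('n) - dim L) > 0" by simp
  have fin: "?cyl \<in> fmeasurable lborel" using L K by (rule cylinder_fmeasurable)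
  {
    assume r: "cball 0 r \<subseteq> K"
    have "cball 0 (min r 1) \<subseteq> ?cyl"
      using r norm_closest_point_subspace_le[OF L] order_trans by (fastforce simp: subset_eq)
    then have "measure lborel (cball 0 (min r 1) :: (real ^ 'n) set) \<le> measure lborel ?cyl"
      using fin by (intro measure_mono_fmeasurable) auto
    then show "measure lborel (cball 0 (min r 1) :: (real ^ 'n) set) / unit_ball_vol (CARD('n) - dim L) \<le> section_volume K L"
      using pos by (simp add: section_volume_eq[OF L b] divide_right_mono)
  }
  {
    assume R: "K \<subseteq> cball 0 R"
    have "measure lborel ?cyl \<le> measure lborel (cball 0 (R + 1) :: (real ^ 'n) set)"
      using cylinder_subset_cball[OF R, of L] cyl
      emeasure_lborel_cball_finite[of "0 :: real^'n" "R + 1"]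
      by (intro measure_mono_fmeasurable) (auto simp: fmeasurable_def)
    then show "section_volume K L \<le> measure lborel (cball 0 (R + 1) :: (real ^ 'n) set) / unit_ball_vol (CARD('n) - dim L)"
      using pos by (simp add: section_volume_eq[OF L b] divide_right_mono)
  }
qed

section \<open>The Haar probability measure on a Grassmannian\<close>

lemma matrix_closest_point_vector_mult:
  fixes L :: "(real ^ 'n) set"
  shows "subspace L \<Longrightarrow> matrix (closest_point L) *v x = closest_point L x"
  by (simp add: matrix_works linear_closest_point_subspace)

lemma measurable_matrix_vector_mult [measurable (raw)]:
  fixes A :: "'a \<Rightarrow> real ^ 'n ^ 'm" and x :: "'a \<Rightarrow> real ^ 'n"
  assumes "A \<in> borel_measurable M" "x \<in> borel_measurable M"
  shows "(\<lambda>z. A z *v x z) \<in> borel_measurable M"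
proof -
  have "continuous_on UNIV (\<lambda>p :: (real ^ 'n ^ 'm) \<times> (real ^ 'n). fst p *v snd p)"
    unfolding matrix_vector_mult_def
    by (intro continuous_on_vec_lambda continuous_intros)
  then show ?thesis by (rule borel_measurable_continuous_Pair[OF assms])
qed

lemma measurable_outer_product [measurable (raw)]:
  fixes x :: "'a \<Rightarrow> real ^ 'n"
  assumes "x \<in> borel_measurable M"
  shows "(\<lambda>z. (\<chi> i j. x z $ i * x z $ j) :: real ^ 'n ^ 'n) \<in> borel_measurable M"
proof -
  have "continuous_on UNIV (\<lambda>x. (\<chi> i j. x $ i * x $ j) :: real ^ 'n ^ 'n)"
    by (intro continuous_on_vec_lambda continuous_intros)
  then show ?thesis
    using measurable_compose[OF assms borel_measurable_continuous_onI] by blast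
qed

text \<open>
  One Gram-Schmidt step for projection matrices. It shows that adding a vector to a subspace is a
  measurable operation on Grassmannians.
\<close>

lemma matrix_closest_point_span_insert:
  fixes L :: "(real ^ 'n) set"
  assumes L: "subspace L" and y: "y \<noteq> 0" "\<And>z. z \<in> L \<Longrightarrow> y \<bullet> z = 0"
  shows "matrix (closest_point (span (insert y L)))
    = matrix (closest_point L) + (1 / (y \<bullet> y)) *\<^sub>R (\<chi> i j. y $ i * y $ j)"
  by (simp add: matrix_def vec_eq_iff closest_point_span_insert[OF assms] inner_axis' inner_axis mult.commute)

lemma matrix_closest_point_orthogonal_image:
  fixes L :: "(real ^ 'n) set" and g :: "real ^ 'n \<Rightarrow> real ^ 'n"
  assumes g: "orthogonal_transformation g" and L: "subspace L"
  shows "matrix (closest_point (g ` L)) = matrix g ** matrix (closest_point L) ** matrix (adjoint g)"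
proof -
  have lin: "linear g" using g by (rule orthogonal_transformation_linear)
  have "g (adjoint g x) = x" for x
  proof -
    obtain z where z: "x = g z" using orthogonal_transformation_surj[OF g] by (metis surjD)
    have "w \<bullet> adjoint g (g z) = w \<bullet> z" for w
      using g adjoint_works[OF lin, of w "g z"] by (simp add: orthogonal_transformation_def inner_commute)
    then have "adjoint g (g z) = z" using vector_eq_ldot by blast
    then show ?thesis using z by simp
  qed
  then have "closest_point (g ` L) x = g (closest_point L (adjoint g x))" for x
    using closest_point_orthogonal_image[OF g L, of "adjoint g x"] by simp
  then have "closest_point (g ` L) = g \<circ> (closest_point L \<circ> adjoint g)"
    by (simp add: fun_eq_iff)
  then show ?thesis
    using lin linear_closest_point_subspace[OF L] adjoint_linear[OF lin]
    by (simp add: matrix_compose matrix_mul_assoc linear_compose)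
qed

lemma space_grassmannian_borel [simp]: "space (grassmannian_borel V k) = grassmannian V k"
  by (simp add: grassmannian_borel_def)

lemma grassmannianD:
  assumes "L \<in> grassmannian V k"
  shows "subspace L" "L \<subseteq> V" "dim L = k"
  using assms by (auto simp: grassmannian_def)

lemma measurable_matrix_closest_point [measurable]:
  "(\<lambda>L. matrix (closest_point L)) \<in> borel_measurable (grassmannian_borel V k)"
  unfolding grassmannian_borel_def by (rule measurable_vimage_algebra1) simp

lemma measurable_grassmannian_borelI:
  assumes "\<And>x. x \<in> space M \<Longrightarrow> f x \<in> grassmannian V k"
    and "(\<lambda>x. matrix (closest_point (f x))) \<in> borel_measurable M"
  shows "f \<in> M \<rightarrow>\<^sub>M grassmannian_borel V k"
  unfolding grassmannian_borel_def using assms by (intro measurable_vimage_algebra2) auto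

lemma orthogonal_image_grassmannian:
  fixes V L :: "(real ^ 'n) set"
  assumes g: "orthogonal_transformation g" "g ` V = V" and L: "L \<in> grassmannian V k"
  shows "g ` L \<in> grassmannian V k"
  using assms orthogonal_transformation_linear[OF g(1)] orthogonal_transformation_inj[OF g(1)]
  unfolding grassmannian_def
  by (auto simp: linear_subspace_image dim_image_eq inj_on_subset)

lemma measurable_orthogonal_image:
  fixes V :: "(real ^ 'n) set"
  assumes g: "orthogonal_transformation g" "g ` V = V"
  shows "(\<lambda>L. g ` L) \<in> grassmannian_borel V k \<rightarrow>\<^sub>M grassmannian_borel V k"
proof (rule measurable_grassmannian_borelI)
  fix L assume "L \<in> space (grassmannian_borel V k)"
  then show "g ` L \<in> grassmannian V k" using orthogonal_image_grassmannian[OF g] by simp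
next
  have "continuous_on UNIV (\<lambda>A. matrix g ** A ** matrix (adjoint g))"
    unfolding matrix_matrix_mult_def by (intro continuous_on_vec_lambda continuous_intros)
  then have "(\<lambda>L. matrix g ** matrix (closest_point L) ** matrix (adjoint g)) \<in> borel_measurable (grassmannian_borel V k)"
    by (rule measurable_compose[OF measurable_matrix_closest_point borel_measurable_continuous_onI])
  then show "(\<lambda>L. matrix (closest_point (g ` L))) \<in> borel_measurable (grassmannian_borel V k)"
    by (rule measurable_cong[THEN iffD1, rotated])
       (simp add: matrix_closest_point_orthogonal_image[OF g(1)] grassmannianD(1))
qed

definition uniform_unit_ball :: "'a::euclidean_space measure" where
  "uniform_unit_ball = uniform_measure lborel (cball 0 1)"

lemma emeasure_unit_cball: "emeasure lborel (cball 0 1 :: 'a::euclidean_space set) \<noteq> 0"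
    "emeasure lborel (cball 0 1 :: 'a::euclidean_space set) \<noteq> \<infinity>"
proof -
  have "unit_ball_vol (real DIM('a)) \<noteq> 0" by (rule less_imp_neq[symmetric]) simp
  then show "emeasure lborel (cball 0 1 :: 'a::euclidean_space set) \<noteq> 0"
    by (simp add: emeasure_cball)
  show "emeasure lborel (cball 0 1 :: 'a::euclidean_space set) \<noteq> \<infinity>"
    using emeasure_lborel_cball_finite[of "0::'a" 1] by simp
qed

lemma sets_uniform_unit_ball [simp, measurable_cong]: "sets uniform_unit_ball = sets borel"
  by (simp add: uniform_unit_ball_def)

lemma prob_space_uniform_unit_ball: "prob_space uniform_unit_ball"
  unfolding uniform_unit_ball_def using emeasure_unit_cball by (intro prob_space_uniform_measure) auto

lemma uniform_unit_ball_orthogonal_transformation: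
  fixes g :: "'a::euclidean_space \<Rightarrow> 'a"
  assumes g: "orthogonal_transformation g"
  shows "distr uniform_unit_ball borel g = uniform_unit_ball"
proof (rule measure_eqI)
  have [measurable]: "g \<in> borel_measurable borel"
    using orthogonal_transformation_linear[OF g]
    by (intro borel_measurable_continuous_onI linear_continuous_on linear_linear[THEN iffD2])
  fix A assume "A \<in> sets (distr uniform_unit_ball borel g)"
  then have A[measurable]: "A \<in> sets borel" by simp
  have gA: "g -` A \<in> sets borel" using measurable_sets[of g borel borel A] by simp
  have "cball 0 1 \<inter> g -` A = g -` (cball 0 1 \<inter> A)"
    using g by (auto simp: orthogonal_transformation_norm)
  then have "emeasure lborel (cball 0 1 \<inter> g -` A) = emeasure (distr lborel borel g) (cball 0 1 \<inter> A)"
    by (subst emeasure_distr) auto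
  then show "emeasure (distr uniform_unit_ball borel g) A = emeasure uniform_unit_ball A"
    unfolding lborel_orthogonal_transformation[OF g]
    using gA A by (simp add: emeasure_distr uniform_unit_ball_def emeasure_uniform_measure)
qed simp

text \<open>
  A random vector is almost surely in general position with respect to a given subspace.
\<close>

lemma proper_subspace_uniform_unit_ball:
  fixes S :: "'a::euclidean_space set"
  assumes S: "subspace S" "S \<noteq> UNIV"
  shows "AE x in uniform_unit_ball. x \<notin> S"
proof -
  have "dim S \<noteq> DIM('a)" using S by (metis dim_eq_full span_eq_iff)
  then have "dim S < DIM('a)" using dim_subset_UNIV[of S] by simp
  then have "negligible S" by (rule negligible_lowdim)
  moreover have "S \<in> sets lborel" using closed_subspace[OF S(1)] by simp
  ultimately have "S \<in> null_sets lborel"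
    by (simp add: negligible_iff_null_sets null_sets_completion_iff)
  then have "AE x in lborel. x \<notin> S" by (rule AE_not_in)
  then show ?thesis unfolding uniform_unit_ball_def
    by (intro AE_uniform_measureI) auto
qed

lemma extension_direction:
  fixes V L :: "'a::euclidean_space set"
  assumes V: "subspace V" and L: "subspace L" "L \<subseteq> V"
  shows "closest_point V x - closest_point L x \<in> V"
    and "z \<in> L \<Longrightarrow> (closest_point V x - closest_point L x) \<bullet> z = 0"
proof -
  show "closest_point V x - closest_point L x \<in> V"
    using closest_point_subspace_in[OF V] closest_point_subspace_in[OF L(1)] L(2) V by (blast intro: subspace_diff)
  assume z: "z \<in> L"
  have "(x - closest_point L x) \<bullet> z = 0" "(x - closest_point V x) \<bullet> z = 0"
    using closest_point_subspace_orthogonal[OF L(1) z] closest_point_subspace_orthogonal[OF V, of z] z L(2) by blast+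
  then show "(closest_point V x - closest_point L x) \<bullet> z = 0" by (simp add: inner_diff_left)
qed

text \<open>
  The span of \<open>L\<close> and the projection of \<open>x\<close> to \<open>V\<close>, written with the component \<open>y\<close> of that projection
  that is orthogonal to \<open>L\<close>. The value \<open>L0\<close> is used on the null event that the dimension does not grow.
\<close>

definition extend_subspace ::
    "'a::euclidean_space set \<Rightarrow> 'a set \<Rightarrow> 'a set \<times> 'a \<Rightarrow> 'a set" where
  "extend_subspace V L0 p = (case p of (L, x) \<Rightarrow>
     let y = closest_point V x - closest_point L x in if y = 0 then L0 else span (insert y L))"

lemma span_insert_grassmannian:
  fixes L :: "(real ^ 'n) set"
  assumes V: "subspace V" and L: "L \<in> grassmannian V k"
    and y: "y \<in> V" "y \<noteq> 0" "\<And>z. z \<in> L \<Longrightarrow> y \<bullet> z = 0"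
  shows "span (insert y L) \<in> grassmannian V (Suc k)"
proof -
  note L' = grassmannianD[OF L]
  have "y \<notin> L" using y(2,3) inner_eq_zero_iff by blast
  then have "y \<notin> span L" using L'(1) by (simp add: span_eq_iff[THEN iffD2])
  moreover have "span (insert y L) \<subseteq> V" using V y L' by (intro span_minimal) auto
  ultimately show ?thesis using L' by (simp add: grassmannian_def dim_insert)
qed

lemma measurable_extend_subspace:
  fixes V :: "(real ^ 'n) set"
  assumes V: "subspace V" and L0: "L0 \<in> grassmannian V (Suc k)"
  shows "extend_subspace V L0 \<in> grassmannian_borel V k \<Otimes>\<^sub>M borel \<rightarrow>\<^sub>M grassmannian_borel V (Suc k)"
proof (rule measurable_grassmannian_borelI)
  fix p assume "p \<in> space (grassmannian_borel V k \<Otimes>\<^sub>M (borel :: (real ^ 'n) measure))"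
  then obtain L x where p: "p = (L, x)" and L: "L \<in> grassmannian V k"
    by (auto simp: space_pair_measure)
  show "extend_subspace V L0 p \<in> grassmannian V (Suc k)"
    using span_insert_grassmannian[OF V L extension_direction(1)[OF V grassmannianD(1,2)[OF L], of x] _
        extension_direction(2)[OF V grassmannianD(1,2)[OF L], of _ x]] L0
    by (auto simp: p extend_subspace_def Let_def)
next
  define y where "y p = closest_point V (snd p) - matrix (closest_point (fst p)) *v snd p" for p :: "(real ^ 'n) set \<times> (real ^ 'n)"
  note [measurable] = borel_measurable_closest_point_subspace[OF V]
  have [measurable]: "y \<in> borel_measurable (grassmannian_borel V k \<Otimes>\<^sub>M borel)"
    unfolding y_def by measurable
  have "(\<lambda>p. if y p = 0 then matrix (closest_point L0) else
      matrix (closest_point (fst p)) + (1 / (y p \<bullet> y p)) *\<^sub>R (\<chi> i j. y p $ i * y p $ j))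
      \<in> borel_measurable (grassmannian_borel V k \<Otimes>\<^sub>M borel)"
    by measurable
  then show "(\<lambda>p. matrix (closest_point (extend_subspace V L0 p))) \<in> borel_measurable (grassmannian_borel V k \<Otimes>\<^sub>M borel)"
  proof (rule measurable_cong[THEN iffD1, rotated])
    fix p assume "p \<in> space (grassmannian_borel V k \<Otimes>\<^sub>M (borel :: (real ^ 'n) measure))"
    then obtain L x where p: "p = (L, x)" and L: "L \<in> grassmannian V k"
      by (auto simp: space_pair_measure)
    note L' = grassmannianD[OF L]
    have y: "y p = closest_point V x - closest_point L x"
      using L' by (simp add: y_def p matrix_closest_point_vector_mult)
    show "(if y p = 0 then matrix (closest_point L0) else
      matrix (closest_point (fst p)) + (1 / (y p \<bullet> y p)) *\<^sub>R (\<chi> i j. y p $ i * y p $ j)) =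
      matrix (closest_point (extend_subspace V L0 p))"
      using matrix_closest_point_span_insert[OF L'(1), of "y p"] extension_direction(2)[OF V L'(1,2), of _ x]
      unfolding y by (auto simp: extend_subspace_def p Let_def)
  qed
qed

text \<open>
  A random \<open>(k + 1)\<close>-dimensional subspace is obtained from a random \<open>k\<close>-dimensional one by adding the
  projection to \<open>V\<close> of an independent uniformly distributed vector of the unit ball. The construction
  commutes almost surely with the orthogonal transformations that preserve \<open>V\<close>, and these preserve the
  joint distribution of the two ingredients; hence the new distribution is invariant.
\<close>

lemma haar_probability_Suc:
  fixes V :: "(real ^ 'n) set"
  assumes V: "subspace V" and k: "k < dim V" and nu: "is_haar_probability V k \<nu>"
  shows "\<exists>\<nu>'. is_haar_probability V (Suc k) \<nu>'"
proof -
  obtain L0 where "L0 \<in> grassmannian V (Suc k)"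
  proof -
    obtain T where "subspace T" "T \<subseteq> span V" "dim T = Suc k"
      using k by (metis Suc_leI choose_subspace_of_subspace)
    then show thesis using that V by (auto simp: grassmannian_def span_eq_iff[THEN iffD2])
  qed
  note L0 = this
  interpret nu: prob_space \<nu> using nu by (simp add: is_haar_probability_def)
  interpret mu: prob_space "uniform_unit_ball :: (real ^ 'n) measure" by (rule prob_space_uniform_unit_ball)
  interpret pair_prob_space \<nu> "uniform_unit_ball :: (real ^ 'n) measure" ..
  let ?\<mu> = "uniform_unit_ball :: (real ^ 'n) measure" and ?G = "grassmannian_borel V (Suc k)"
  have s[measurable_cong]: "sets \<nu> = sets (grassmannian_borel V k)" using nu by (simp add: is_haar_probability_def)
  then have sp: "space \<nu> = grassmannian V k" by (auto dest: sets_eq_imp_space_eq)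
  let ?e = "extend_subspace V L0"
  have e[measurable]: "?e \<in> \<nu> \<Otimes>\<^sub>M ?\<mu> \<rightarrow>\<^sub>M ?G"
    using measurable_extend_subspace[OF V L0] by (simp cong: measurable_cong_sets)
  \<comment> \<open>For fixed \<open>L\<close> the exceptional \<open>x\<close> form a proper subspace, as \<open>L\<close> is a proper subspace of \<open>V\<close>.\<close>
  have generic: "AE p in \<nu> \<Otimes>\<^sub>M ?\<mu>. closest_point V (snd p) - closest_point (fst p) (snd p) \<noteq> 0"
  proof -
    have "AE L in \<nu>. AE x in ?\<mu>. 0 < norm (closest_point V x - matrix (closest_point L) *v x)"
    proof (rule AE_I2)
      fix L assume "L \<in> space \<nu>"
      then have L: "subspace L" "L \<subseteq> V" "dim L = k" using sp grassmannianD by blast+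
      let ?S = "{x. closest_point V x - closest_point L x = 0}"
      have "linear (\<lambda>x. closest_point V x - closest_point L x)"
        using V L by (intro linear_compose_sub linear_closest_point_subspace)
      then have "subspace ?S" by (rule linear_subspace_kernel)
      moreover have "?S \<noteq> UNIV"
      proof -
        obtain x where x: "x \<in> V" "x \<notin> L" using L k by (metis less_irrefl subsetI subset_antisym)
        then have "closest_point V x = x" by (simp add: closest_point_self)
        moreover have "closest_point L x \<noteq> x" using x closest_point_subspace_in[OF L(1), of x] by metis
        ultimately have "x \<notin> ?S" by simp
        then show ?thesis by blast
      qed
      ultimately show "AE x in ?\<mu>. 0 < norm (closest_point V x - matrix (closest_point L) *v x)"
        using proper_subspace_uniform_unit_ball[of ?S] L(1) by (simp add: matrix_closest_point_vector_mult)
    qed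
    note [measurable] = borel_measurable_closest_point_subspace[OF V]
    define y where "y p = closest_point V (snd p) - matrix (closest_point (fst p)) *v snd p" for p :: "(real ^ 'n) set \<times> (real ^ 'n)"
    have "y \<in> borel_measurable (grassmannian_borel V k \<Otimes>\<^sub>M borel)"
      unfolding y_def by measurable
    then have [measurable]: "y \<in> borel_measurable (\<nu> \<Otimes>\<^sub>M ?\<mu>)"
      using s by (simp cong: measurable_cong_sets sets_pair_measure_cong)
    have "{p \<in> space (\<nu> \<Otimes>\<^sub>M ?\<mu>). 0 < norm (y p)} \<in> sets (\<nu> \<Otimes>\<^sub>M ?\<mu>)" by measurable
    moreover have "AE L in \<nu>. AE x in ?\<mu>. 0 < norm (y (L, x))"
      unfolding y_def fst_conv snd_conv by fact
    ultimately have "AE p in \<nu> \<Otimes>\<^sub>M ?\<mu>. 0 < norm (y p)"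
      by (rule AE_pair_measure)
    then have "AE p in \<nu> \<Otimes>\<^sub>M ?\<mu>. 0 < norm (closest_point V (snd p) - matrix (closest_point (fst p)) *v snd p)"
      by (simp only: y_def)
    then show ?thesis
      by (rule AE_mp) (auto simp: space_pair_measure sp matrix_closest_point_vector_mult grassmannianD(1) intro!: AE_I2)
  qed
  have "is_haar_probability V (Suc k) (distr (\<nu> \<Otimes>\<^sub>M ?\<mu>) ?G ?e)"
    unfolding is_haar_probability_def
  proof (intro conjI allI impI)
    show "prob_space (distr (\<nu> \<Otimes>\<^sub>M ?\<mu>) ?G ?e)" by (rule prob_space_distr) (rule e)
    fix g :: "real ^ 'n \<Rightarrow> real ^ 'n" assume "orthogonal_transformation g \<and> g ` V = V"
    then have g: "orthogonal_transformation g" "g ` V = V" by auto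
    have lin: "linear g" using g by (simp add: orthogonal_transformation_linear)
    have mg[measurable]: "g \<in> borel_measurable borel"
      using lin by (intro borel_measurable_continuous_onI linear_continuous_on linear_linear[THEN iffD2])
    have mG: "(\<lambda>L. g ` L) \<in> grassmannian_borel V j \<rightarrow>\<^sub>M grassmannian_borel V j" for j
      by (rule measurable_orthogonal_image[OF g])
    note [measurable] = mG[of k] mG[of "Suc k"]
    have nug: "distr \<nu> (grassmannian_borel V k) (\<lambda>L. g ` L) = \<nu>"
      using nu g by (simp add: is_haar_probability_def)
    have mug: "distr ?\<mu> borel g = ?\<mu>" by (rule uniform_unit_ball_orthogonal_transformation[OF g(1)])
    have prod: "distr (\<nu> \<Otimes>\<^sub>M ?\<mu>) (grassmannian_borel V k \<Otimes>\<^sub>M borel) (\<lambda>(L, x). (g ` L, g x)) = \<nu> \<Otimes>\<^sub>M ?\<mu>"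
      using pair_measure_distr[of "\<lambda>L. g ` L" \<nu> "grassmannian_borel V k" g ?\<mu> borel] nug mug
      by (simp add: mu.sigma_finite_measure_axioms)
    have commute: "AE p in \<nu> \<Otimes>\<^sub>M ?\<mu>. g ` ?e p = ?e (case p of (L, x) \<Rightarrow> (g ` L, g x))"
      using generic
    proof (rule AE_mp, intro AE_I2 impI)
      fix p assume "p \<in> space (\<nu> \<Otimes>\<^sub>M ?\<mu>)" and ne: "closest_point V (snd p) - closest_point (fst p) (snd p) \<noteq> 0"
      then obtain L x where p: "p = (L, x)" and "L \<in> grassmannian V k"
        by (auto simp: space_pair_measure sp)
      then have L: "subspace L" using grassmannianD by blast
      let ?y = "closest_point V x - closest_point L x"
      have y: "closest_point V (g x) - closest_point (g ` L) (g x) = g ?y"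
        using closest_point_orthogonal_image[OF g(1) V, of x] closest_point_orthogonal_image[OF g(1) L, of x] g(2) lin
        by (simp add: linear_diff)
      have "?y \<noteq> 0" using ne p by simp
      moreover have "g ?y \<noteq> 0" using \<open>?y \<noteq> 0\<close> g(1) by (metis norm_eq_zero orthogonal_transformation_norm)
      moreover have "g ` span (insert ?y L) = span (insert (g ?y) (g ` L))"
        using lin by (metis image_insert linear_span_image)
      ultimately show "g ` ?e p = ?e (case p of (L, x) \<Rightarrow> (g ` L, g x))"
        unfolding p extend_subspace_def Let_def prod.case y by (simp only: if_False)
    qed
    have "distr (distr (\<nu> \<Otimes>\<^sub>M ?\<mu>) ?G ?e) ?G (\<lambda>L. g ` L) = distr (\<nu> \<Otimes>\<^sub>M ?\<mu>) ?G (\<lambda>p. g ` ?e p)"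
      by (subst distr_distr) (auto simp: comp_def)
    also have "\<dots> = distr (\<nu> \<Otimes>\<^sub>M ?\<mu>) ?G (\<lambda>p. ?e (case p of (L, x) \<Rightarrow> (g ` L, g x)))"
      using commute by (intro distr_cong_AE) auto
    also have "\<dots> = distr (distr (\<nu> \<Otimes>\<^sub>M ?\<mu>) (grassmannian_borel V k \<Otimes>\<^sub>M borel) (\<lambda>(L, x). (g ` L, g x))) ?G ?e"
      using measurable_extend_subspace[OF V L0] by (subst distr_distr) (auto simp: comp_def)
    also have "\<dots> = distr (\<nu> \<Otimes>\<^sub>M ?\<mu>) ?G ?e" by (simp add: prod)
    finally show "distr (distr (\<nu> \<Otimes>\<^sub>M ?\<mu>) ?G ?e) ?G (\<lambda>L. g ` L) = distr (\<nu> \<Otimes>\<^sub>M ?\<mu>) ?G ?e" .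
  qed simp
  then show ?thesis by blast
qed

lemma haar_probability_exists:
  fixes V :: "(real ^ 'n) set"
  assumes V: "subspace V"
  shows "k \<le> dim V \<Longrightarrow> \<exists>\<nu>. is_haar_probability V k \<nu>"
proof (induction k)
  case 0
  have 0: "{0} \<in> grassmannian V 0" using V by (simp add: grassmannian_def subspace_0)
  have "is_haar_probability V 0 (return (grassmannian_borel V 0) {0})"
    unfolding is_haar_probability_def
  proof (intro conjI allI impI)
    show "prob_space (return (grassmannian_borel V 0) {0})" using 0 by (intro prob_space_return) simp
    fix g :: "real ^ 'n \<Rightarrow> real ^ 'n" assume "orthogonal_transformation g \<and> g ` V = V"
    then have g: "orthogonal_transformation g" "g ` V = V" by auto
    show "distr (return (grassmannian_borel V 0) {0}) (grassmannian_borel V 0) (\<lambda>L. g ` L) = return (grassmannian_borel V 0) {0}"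
      using measurable_orthogonal_image[OF g] 0 orthogonal_transformation_linear[OF g(1)]
      by (subst distr_return) (auto simp: linear_0)
  qed simp
  then show ?case by blast
next
  case (Suc k)
  then show ?case using haar_probability_Suc[OF V] by (metis Suc_leD Suc_le_eq)
qed

lemma is_haar_probability_haar_grassmannian:
  fixes V :: "(real ^ 'n) set"
  assumes "subspace V" "k \<le> dim V"
  shows "is_haar_probability V k (haar_grassmannian V k)"
  unfolding haar_grassmannian_def using haar_probability_exists[OF assms] by (rule someI_ex)

section \<open>The dual Radon transform of the section function\<close>

text \<open>
  By the cylinder formula the section volume is a constant times the measure of a section of a Borel set of
  pairs of a matrix and a point, hence a measurable function of the projection matrix.
\<close>

lemma measurable_section_volume:
  fixes K V :: "(real ^ 'n) set"
  assumes K: "compact K"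
  shows "section_volume K \<in> borel_measurable (grassmannian_borel V k)"
proof -
  let ?Q = "{p. fst p *v snd p \<in> K \<and> norm (snd p - fst p *v snd p) \<le> 1} :: ((real ^ 'n ^ 'n) \<times> (real ^ 'n)) set"
  note [measurable] = borel_compact[OF K]
  have "?Q \<in> sets (borel \<Otimes>\<^sub>M lborel)"
  proof -
    have "{p \<in> space (borel \<Otimes>\<^sub>M lborel). fst p *v snd p \<in> K \<and> norm (snd p - fst p *v snd p) \<le> 1}
        \<in> sets ((borel :: (real ^ 'n ^ 'n) measure) \<Otimes>\<^sub>M (lborel :: (real ^ 'n) measure))"
      by measurable
    then show ?thesis by (simp add: space_pair_measure)
  qed
  from lborel.measurable_emeasure_Pair[OF this]
  have "(\<lambda>A. emeasure lborel (Pair A -` ?Q)) \<in> borel_measurable borel" .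
  then have [measurable]: "(\<lambda>A. measure lborel {x. A *v x \<in> K \<and> norm (x - A *v x) \<le> 1}) \<in> borel_measurable borel"
    unfolding measure_def by (simp add: vimage_def)
  have "(\<lambda>L. measure lborel {x. matrix (closest_point L) *v x \<in> K \<and> norm (x - matrix (closest_point L) *v x) \<le> 1}
       / unit_ball_vol (CARD('n) - k)) \<in> borel_measurable (grassmannian_borel V k)"
    by measurable
  then show ?thesis
    by (rule measurable_cong[THEN iffD1, rotated])
       (use K in \<open>auto simp: grassmannian_def section_volume_eq borel_compact matrix_closest_point_vector_mult\<close>)
qed

lemma span_insert_hyperplane_grassmannian:
  fixes Z :: "(real ^ 'n) set"
  assumes u: "norm u = 1" and Z: "Z \<in> grassmannian {x. u \<bullet> x = 0} k"
  shows "span (insert u Z) \<in> grassmannian UNIV (Suc k)"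
proof (rule span_insert_grassmannian)
  show "Z \<in> grassmannian UNIV k" using Z by (auto simp: grassmannian_def)
  show "u \<bullet> z = 0" if "z \<in> Z" for z using that Z by (auto simp: grassmannian_def)
qed (use u in auto)

lemma measurable_span_insert_hyperplane:
  fixes u :: "real ^ 'n"
  assumes u: "norm u = 1"
  shows "(\<lambda>Z. span (insert u Z)) \<in> grassmannian_borel {x. u \<bullet> x = 0} k \<rightarrow>\<^sub>M grassmannian_borel UNIV (Suc k)"
proof (rule measurable_grassmannian_borelI)
  fix Z assume "Z \<in> space (grassmannian_borel {x. u \<bullet> x = 0} k)"
  then show "span (insert u Z) \<in> grassmannian UNIV (Suc k)"
    using span_insert_hyperplane_grassmannian[OF u] by simp
next
  have "(\<lambda>Z. matrix (closest_point Z) + (1 / (u \<bullet> u)) *\<^sub>R (\<chi> i j. u $ i * u $ j))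
      \<in> borel_measurable (grassmannian_borel {x. u \<bullet> x = 0} k)"
    by measurable
  then show "(\<lambda>Z. matrix (closest_point (span (insert u Z)))) \<in> borel_measurable (grassmannian_borel {x. u \<bullet> x = 0} k)"
  proof (rule measurable_cong[THEN iffD1, rotated])
    fix Z assume "Z \<in> space (grassmannian_borel {x. u \<bullet> x = 0} k)"
    then have "subspace Z" "\<And>z. z \<in> Z \<Longrightarrow> u \<bullet> z = 0" by (auto simp: grassmannian_def)
    then show "matrix (closest_point Z) + (1 / (u \<bullet> u)) *\<^sub>R (\<chi> i j. u $ i * u $ j) = matrix (closest_point (span (insert u Z)))"
      using u by (subst matrix_closest_point_span_insert) auto
  qed
qed

context
  fixes u :: "real ^ 'n" and m :: nat
  assumes u: "norm u = 1" and m: "1 \<le> m" "m \<le> CARD('n)"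
begin

lemma haar_hyperplane:
  "prob_space (haar_grassmannian {x. u \<bullet> x = 0} (m - 1))"
  "sets (haar_grassmannian {x. u \<bullet> x = 0} (m - 1)) = sets (grassmannian_borel {x. u \<bullet> x = 0} (m - 1))"
  "space (haar_grassmannian {x. u \<bullet> x = 0} (m - 1)) = grassmannian {x. u \<bullet> x = 0} (m - 1)"
proof -
  have "u \<noteq> 0" using u by auto
  then have "dim {x. u \<bullet> x = 0} = CARD('n) - 1" by (simp add: dim_hyperplane)
  then have "is_haar_probability {x. u \<bullet> x = 0} (m - 1) (haar_grassmannian {x. u \<bullet> x = 0} (m - 1))"
    using m by (intro is_haar_probability_haar_grassmannian subspace_hyperplane) auto
  then show "prob_space (haar_grassmannian {x. u \<bullet> x = 0} (m - 1))"
    and *: "sets (haar_grassmannian {x. u \<bullet> x = 0} (m - 1)) = sets (grassmannian_borel {x. u \<bullet> x = 0} (m - 1))"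
    by (auto simp: is_haar_probability_def)
  from sets_eq_imp_space_eq[OF *]
  show "space (haar_grassmannian {x. u \<bullet> x = 0} (m - 1)) = grassmannian {x. u \<bullet> x = 0} (m - 1)" by simp
qed

lemma span_insert_haar_hyperplane:
  assumes "Z \<in> space (haar_grassmannian {x. u \<bullet> x = 0} (m - 1))"
  shows "subspace (span (insert u Z))" "dim (span (insert u Z)) = m"
  using grassmannianD[OF span_insert_hyperplane_grassmannian[OF u assms[unfolded haar_hyperplane(3)]]] m
  by simp_all

lemma integrable_section_volume_power:
  fixes K :: "(real ^ 'n) set"
  assumes K: "compact K"
  shows "integrable (haar_grassmannian {x. u \<bullet> x = 0} (m - 1)) (\<lambda>Z. section_volume K (span (insert u Z)) ^ j)"
proof -
  let ?\<nu> = "haar_grassmannian {x. u \<bullet> x = 0} (m - 1)"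
  interpret prob_space ?\<nu> by (rule haar_hyperplane)
  obtain R where R: "K \<subseteq> cball 0 R"
    using compact_imp_bounded[OF K] bounded_iff[of K] by (force simp: subset_eq)
  let ?B = "measure lborel (cball 0 (R + 1) :: (real ^ 'n) set) / unit_ball_vol (CARD('n) - m)"
  show ?thesis
  proof (rule integrable_const_bound)
    show "AE Z in ?\<nu>. norm (section_volume K (span (insert u Z)) ^ j) \<le> ?B ^ j"
    proof (rule AE_I2)
      fix Z assume Z: "Z \<in> space ?\<nu>"
      note L = span_insert_haar_hyperplane[OF Z]
      have "section_volume K (span (insert u Z)) \<le> ?B"
        using section_volume_le[OF L(1) K R] L(2) by simp
      moreover have "0 \<le> section_volume K (span (insert u Z))" by (simp add: section_volume_def)
      ultimately show "norm (section_volume K (span (insert u Z)) ^ j) \<le> ?B ^ j"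
        by (simp add: power_mono)
    qed
    have "(\<lambda>Z. section_volume K (span (insert u Z))) \<in> borel_measurable (grassmannian_borel {x. u \<bullet> x = 0} (m - 1))"
      using measurable_compose[OF measurable_span_insert_hyperplane[OF u] measurable_section_volume[OF K]] .
    then show "(\<lambda>Z. section_volume K (span (insert u Z)) ^ j) \<in> borel_measurable ?\<nu>"
      unfolding measurable_cong_sets[OF haar_hyperplane(2) refl] by (rule borel_measurable_power)
  qed
qed

lemma dual_radon_section_mono:
  fixes K K' :: "(real ^ 'n) set"
  assumes "compact K" "compact K'" "K \<subseteq> K'"
  shows "dual_radon m (\<lambda>L. section_volume K L ^ j) u \<le> dual_radon m (\<lambda>L. section_volume K' L ^ j) u"
  unfolding dual_radon_def
proof (rule mult_left_mono)
  show "(LINT Z | haar_grassmannian {x. u \<bullet> x = 0} (m - 1). section_volume K (span (insert u Z)) ^ j)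
      \<le> (LINT Z | haar_grassmannian {x. u \<bullet> x = 0} (m - 1). section_volume K' (span (insert u Z)) ^ j)"
  proof (rule integral_mono)
    fix Z assume "Z \<in> space (haar_grassmannian {x. u \<bullet> x = 0} (m - 1))"
    from section_volume_mono[OF span_insert_haar_hyperplane(1)[OF this] assms]
    show "section_volume K (span (insert u Z)) ^ j \<le> section_volume K' (span (insert u Z)) ^ j"
      by (rule power_mono) (simp add: section_volume_def)
  qed (intro integrable_section_volume_power assms)+
qed simp

lemma dual_radon_section_scale:
  fixes K :: "(real ^ 'n) set"
  assumes K: "compact K" and c: "c > 0"
  shows "dual_radon m (\<lambda>L. section_volume ((*\<^sub>R) c ` K) L ^ j) u = c ^ (m * j) * dual_radon m (\<lambda>L. section_volume K L ^ j) u"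
proof -
  let ?\<nu> = "haar_grassmannian {x. u \<bullet> x = 0} (m - 1)"
  have "(LINT Z | ?\<nu>. section_volume ((*\<^sub>R) c ` K) (span (insert u Z)) ^ j)
      = (LINT Z | ?\<nu>. c ^ (m * j) * section_volume K (span (insert u Z)) ^ j)"
  proof (rule Bochner_Integration.integral_cong)
    fix Z assume "Z \<in> space ?\<nu>"
    note L = span_insert_haar_hyperplane[OF this]
    show "section_volume ((*\<^sub>R) c ` K) (span (insert u Z)) ^ j = c ^ (m * j) * section_volume K (span (insert u Z)) ^ j"
      unfolding section_volume_scale[OF L(1) borel_compact[OF K] c] L(2) by (simp add: power_mult power_mult_distrib)
  qed simp
  then show ?thesis by (simp add: dual_radon_def)
qed

end

text \<open>
  Uniform bounds for the transform come from those for the sections, as the averages are taken with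
  respect to probability measures.
\<close>

lemma dual_radon_section_bounds:
  fixes K :: "(real ^ 'n) set"
  assumes K: "compact K" "0 \<in> interior K" and m: "1 \<le> m" "m \<le> CARD('n)"
  obtains lo hi where "0 < lo" and
    "\<And>u. norm u = 1 \<Longrightarrow> lo \<le> dual_radon m (\<lambda>L. section_volume K L ^ j) u \<and> dual_radon m (\<lambda>L. section_volume K L ^ j) u \<le> hi"
proof -
  obtain R where R: "K \<subseteq> cball 0 R"
    using compact_imp_bounded[OF K(1)] bounded_iff[of K] by (force simp: subset_eq)
  obtain r where r: "r > 0" "cball 0 r \<subseteq> K"
    using K(2) mem_interior_cball by blast
  define a where "a = measure lborel (cball 0 (min r 1) :: (real ^ 'n) set) / unit_ball_vol (CARD('n) - m)"
  define b where "b = measure lborel (cball 0 (R + 1) :: (real ^ 'n) set) / unit_ball_vol (CARD('n) - m)"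
  define \<kappa> where "\<kappa> = (real m * unit_ball_vol (real m)) / (real CARD('n) * unit_ball_vol (real CARD('n)))"
  have \<kappa>: "\<kappa> > 0" using m unfolding \<kappa>_def by (intro divide_pos_pos mult_pos_pos) auto
  have a: "a > 0"
  proof -
    have "measure lborel (cball 0 (min r 1) :: (real ^ 'n) set) > 0"
      using r(1) by (simp add: content_cball)
    then show ?thesis unfolding a_def by (rule divide_pos_pos) simp
  qed
  show thesis
  proof (rule that[of "\<kappa> * a ^ j" "\<kappa> * b ^ j"])
    show "0 < \<kappa> * a ^ j" using \<kappa> a by simp
    fix u :: "real ^ 'n" assume u: "norm u = 1"
    let ?\<nu> = "haar_grassmannian {x. u \<bullet> x = 0} (m - 1)"
    interpret prob_space ?\<nu> using haar_hyperplane(1)[OF u m] .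
    note int = integrable_section_volume_power[OF u m K(1), of j]
    have between: "a ^ j \<le> section_volume K (span (insert u Z)) ^ j" "section_volume K (span (insert u Z)) ^ j \<le> b ^ j"
      if Z: "Z \<in> space ?\<nu>" for Z
    proof -
      note L = span_insert_haar_hyperplane[OF u m Z]
      have "a \<le> section_volume K (span (insert u Z))"
        using section_volume_ge[OF L(1) K(1) r(2)] L(2) by (simp add: a_def)
      then show "a ^ j \<le> section_volume K (span (insert u Z)) ^ j" using a by (intro power_mono) auto
      have "section_volume K (span (insert u Z)) \<le> b"
        using section_volume_le[OF L(1) K(1) R] L(2) by (simp add: b_def)
      then show "section_volume K (span (insert u Z)) ^ j \<le> b ^ j"
        by (intro power_mono) (auto simp: section_volume_def)
    qed
    have "(LINT Z | ?\<nu>. a ^ j) \<le> (LINT Z | ?\<nu>. section_volume K (span (insert u Z)) ^ j)"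
      by (intro integral_mono int integrable_const between)
    moreover have "(LINT Z | ?\<nu>. section_volume K (span (insert u Z)) ^ j) \<le> (LINT Z | ?\<nu>. b ^ j)"
      by (intro integral_mono int integrable_const between)
    ultimately show "\<kappa> * a ^ j \<le> dual_radon m (\<lambda>L. section_volume K L ^ j) u \<and> dual_radon m (\<lambda>L. section_volume K L ^ j) u \<le> \<kappa> * b ^ j"
      using \<kappa> prob_space unfolding dual_radon_def \<kappa>_def[symmetric] by simp
  qed
qed

section \<open>Integrals of arbitrary functions\<close>

text \<open>
  The integral of a nonnegative function that need not be measurable is the supremum of the integrals
  of the simple functions below it. Such a lower integral is still positively homogeneous, and it is
  superadditive if one summand is measurable.
\<close>

lemma nn_integral_cmult_le_arbitrary:
  fixes f :: "'a \<Rightarrow> ennreal"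
  shows "c * (\<integral>\<^sup>+x. f x \<partial>M) \<le> (\<integral>\<^sup>+x. c * f x \<partial>M)"
proof -
  have "c * (\<integral>\<^sup>+x. f x \<partial>M) = (SUP g \<in> {g. simple_function M g \<and> g \<le> f}. c * integral\<^sup>S M g)"
    unfolding nn_integral_def by (rule SUP_mult_left_ennreal)
  also have "\<dots> \<le> (\<integral>\<^sup>+x. c * f x \<partial>M)"
  proof (rule SUP_least)
    fix g assume "g \<in> {g. simple_function M g \<and> g \<le> f}"
    then have g: "simple_function M g" "g \<le> f" by auto
    have "c * integral\<^sup>S M g = (\<integral>\<^sup>+x. c * g x \<partial>M)"
      using g by (simp add: nn_integral_cmult borel_measurable_simple_function nn_integral_eq_simple_integral)
    also have "\<dots> \<le> (\<integral>\<^sup>+x. c * f x \<partial>M)"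
      using g by (intro nn_integral_mono mult_left_mono) (auto simp: le_fun_def)
    finally show "c * integral\<^sup>S M g \<le> (\<integral>\<^sup>+x. c * f x \<partial>M)" .
  qed
  finally show ?thesis .
qed

lemma nn_integral_cmult_arbitrary:
  fixes f :: "'a \<Rightarrow> ennreal"
  assumes c: "c > 0"
  shows "(\<integral>\<^sup>+x. ennreal c * f x \<partial>M) = ennreal c * (\<integral>\<^sup>+x. f x \<partial>M)"
proof (rule antisym)
  have inv: "ennreal c * ennreal (1 / c) = 1"
    using c by (simp add: ennreal_mult[symmetric])
  have "ennreal (1 / c) * (\<integral>\<^sup>+x. ennreal c * f x \<partial>M) \<le> (\<integral>\<^sup>+x. ennreal (1 / c) * (ennreal c * f x) \<partial>M)"
    by (rule nn_integral_cmult_le_arbitrary)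
  also have "\<dots> = (\<integral>\<^sup>+x. f x \<partial>M)"
    by (simp add: mult.assoc[symmetric] inv mult.commute[of "ennreal (1 / c)"] del: ennreal_mult')
  finally have "ennreal c * (ennreal (1 / c) * (\<integral>\<^sup>+x. ennreal c * f x \<partial>M)) \<le> ennreal c * (\<integral>\<^sup>+x. f x \<partial>M)"
    by (rule mult_left_mono) simp
  then show "(\<integral>\<^sup>+x. ennreal c * f x \<partial>M) \<le> ennreal c * (\<integral>\<^sup>+x. f x \<partial>M)"
    unfolding mult.assoc[symmetric] inv by simp
qed (rule nn_integral_cmult_le_arbitrary)

lemma nn_integral_add_le_arbitrary:
  fixes f h :: "'a \<Rightarrow> ennreal"
  assumes h: "h \<in> borel_measurable M"
  shows "(\<integral>\<^sup>+x. f x \<partial>M) + (\<integral>\<^sup>+x. h x \<partial>M) \<le> (\<integral>\<^sup>+x. f x + h x \<partial>M)"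
proof -
  let ?G = "{g. simple_function M g \<and> g \<le> f}"
  have ne: "?G \<noteq> {}" by (auto intro!: exI[of _ "\<lambda>_. 0"] simp: le_fun_def)
  have "(\<integral>\<^sup>+x. f x \<partial>M) + (\<integral>\<^sup>+x. h x \<partial>M) = (SUP g \<in> ?G. integral\<^sup>S M g + (\<integral>\<^sup>+x. h x \<partial>M))"
    unfolding nn_integral_def[of M f] by (rule ennreal_SUP_add_left[OF ne, symmetric])
  also have "\<dots> \<le> (\<integral>\<^sup>+x. f x + h x \<partial>M)"
  proof (rule SUP_least)
    fix g assume "g \<in> ?G"
    then have g: "simple_function M g" "g \<le> f" by auto
    have "integral\<^sup>S M g + (\<integral>\<^sup>+x. h x \<partial>M) = (\<integral>\<^sup>+x. g x + h x \<partial>M)"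
      using g h by (simp add: nn_integral_add borel_measurable_simple_function nn_integral_eq_simple_integral)
    also have "\<dots> \<le> (\<integral>\<^sup>+x. f x + h x \<partial>M)"
      using g by (intro nn_integral_mono add_right_mono) (auto simp: le_fun_def)
    finally show "integral\<^sup>S M g + (\<integral>\<^sup>+x. h x \<partial>M) \<le> (\<integral>\<^sup>+x. f x + h x \<partial>M)" .
  qed
  finally show ?thesis .
qed

section \<open>Spherical Lebesgue measure\<close>

text \<open>
  Spherical Lebesgue measure before completion, on the Borel sets of the sphere.
\<close>

definition spherical_borel :: "(real ^ 'n) measure" where
  "spherical_borel = scale_measure (of_nat CARD('n))
       (distr (restrict_space lborel (cball 0 1 - {0}))
              (restrict_space borel (sphere 0 1))
              (\<lambda>x. x /\<^sub>R norm x))"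

lemma spherical_lebesgue_eq_completion: "spherical_lebesgue = completion spherical_borel"
  by (simp add: spherical_lebesgue_def spherical_borel_def)

lemma sets_spherical_borel: "sets spherical_borel = sets (restrict_space borel (sphere 0 1))"
  by (simp add: spherical_borel_def)

lemma space_spherical_borel: "space spherical_borel = sphere 0 1"
  using sets_eq_imp_space_eq[OF sets_spherical_borel] by (simp add: space_restrict_space)

lemma sphere_Int_in_sets_spherical_borel:
  "S \<in> sets borel \<Longrightarrow> sphere 0 1 \<inter> S \<in> sets spherical_borel"
  by (auto simp: sets_spherical_borel sets_restrict_space)

lemma emeasure_spherical_borel:
  fixes S :: "(real ^ 'n) set"
  assumes S: "S \<in> sets borel"
  shows "emeasure spherical_borel (sphere 0 1 \<inter> S)
    = of_nat CARD('n) * emeasure lborel {x \<in> cball 0 1 - {0}. x /\<^sub>R norm x \<in> S}"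
proof -
  have [measurable]: "(\<lambda>x :: real ^ 'n. x /\<^sub>R norm x) \<in> restrict_space lborel (cball 0 1 - {0}) \<rightarrow>\<^sub>M restrict_space borel (sphere 0 1)"
    by (rule measurable_restrict_space3) auto
  have pre: "(\<lambda>x. x /\<^sub>R norm x) -` (sphere 0 1 \<inter> S) \<inter> space (restrict_space lborel (cball 0 1 - {0}))
      = {x \<in> cball 0 1 - {0}. x /\<^sub>R norm x \<in> S}"
    by (auto simp: space_restrict_space)
  have "sphere 0 1 \<inter> S \<in> sets (restrict_space borel (sphere 0 1))"
    using S by (auto simp: sets_restrict_space)
  then have "emeasure spherical_borel (sphere 0 1 \<inter> S)
    = of_nat CARD('n) * emeasure (restrict_space lborel (cball 0 1 - {0})) {x \<in> cball 0 1 - {0}. x /\<^sub>R norm x \<in> S}"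
    unfolding spherical_borel_def emeasure_scale_measure by (subst emeasure_distr) (simp_all only: pre, measurable)
  also have "emeasure (restrict_space lborel (cball 0 1 - {0})) {x \<in> cball 0 1 - {0}. x /\<^sub>R norm x \<in> S}
    = emeasure lborel {x \<in> cball 0 1 - {0}. x /\<^sub>R norm x \<in> S}"
    by (rule emeasure_restrict_space) auto
  finally show ?thesis .
qed

lemma emeasure_spherical_lebesgue_finite: "emeasure spherical_lebesgue (sphere 0 1 :: (real ^ 'n) set) < \<infinity>"
proof -
  have "emeasure lborel {x \<in> (cball 0 1 - {0} :: (real ^ 'n) set). x /\<^sub>R norm x \<in> UNIV} \<le> emeasure lborel (cball 0 1 :: (real ^ 'n) set)"
    by (rule emeasure_mono) auto
  also have "\<dots> < \<infinity>" by (rule emeasure_lborel_cball_finite)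
  finally have "emeasure spherical_borel (sphere 0 1 \<inter> UNIV :: (real ^ 'n) set) < \<infinity>"
    unfolding emeasure_spherical_borel[OF sets.top[of borel, unfolded space_borel]]
    by (simp add: ennreal_mult_less_top ennreal_of_nat_eq_real_of_nat)
  moreover have "sphere 0 1 \<inter> UNIV \<in> sets (spherical_borel :: (real ^ 'n) measure)"
    by (rule sphere_Int_in_sets_spherical_borel) simp
  ultimately show ?thesis by (simp add: spherical_lebesgue_eq_completion)
qed

lemma AE_spherical_lebesgue_not_orthogonal:
  fixes c :: "real ^ 'n"
  assumes c: "c \<noteq> 0"
  shows "AE u in spherical_lebesgue. c \<bullet> u \<noteq> 0"
proof -
  let ?H = "{x. c \<bullet> x = 0}"
  have H: "?H \<in> sets borel" by measurable
  have "negligible ?H" using c by (intro negligible_hyperplane) simp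
  then have "?H \<in> null_sets lborel"
    using H by (simp add: negligible_iff_null_sets null_sets_completion_iff)
  then have "{x \<in> cball 0 1 - {0}. x /\<^sub>R norm x \<in> ?H} \<in> null_sets lborel"
    by (rule null_sets_subset) auto
  then have "sphere 0 1 \<inter> ?H \<in> null_sets spherical_borel"
    using emeasure_spherical_borel[OF H] sphere_Int_in_sets_spherical_borel[OF H] by (auto simp: null_sets_def)
  then have "AE u in spherical_borel. u \<notin> sphere 0 1 \<inter> ?H" by (rule AE_not_in)
  then have "AE u in spherical_borel. c \<bullet> u \<noteq> 0"
    by (rule AE_mp) (auto simp: space_spherical_borel intro!: AE_I2)
  then show ?thesis unfolding spherical_lebesgue_eq_completion by (rule AE_completion)
qed

lemma emeasure_spherical_lebesgue_open_pos:
  fixes S :: "(real ^ 'n) set"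
  assumes S: "open S" and u: "u \<in> S" "norm u = 1"
  shows "sphere 0 1 \<inter> S \<in> sets spherical_lebesgue" "emeasure spherical_lebesgue (sphere 0 1 \<inter> S) > 0"
proof -
  have Sb: "S \<in> sets borel" using S by simp
  have *: "sphere 0 1 \<inter> S \<in> sets spherical_borel" by (rule sphere_Int_in_sets_spherical_borel[OF Sb])
  then show "sphere 0 1 \<inter> S \<in> sets spherical_lebesgue" by (simp add: spherical_lebesgue_eq_completion)
  let ?T = "(ball 0 1 - {0}) \<inter> (\<lambda>x. x /\<^sub>R norm x) -` S"
  have "continuous_on (ball 0 1 - {0}) (\<lambda>x :: real ^ 'n. x /\<^sub>R norm x)"
    by (intro continuous_intros) auto
  then have T: "open ?T" using S by (intro continuous_open_preimage) auto
  have "(1/2) *\<^sub>R u \<in> ?T" using u by auto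
  then have "\<not> negligible ?T" using T open_not_negligible by blast
  then have "?T \<notin> null_sets lborel"
    using T by (simp add: negligible_iff_null_sets null_sets_completion_iff)
  then have "emeasure lborel ?T \<noteq> 0" using T by auto
  moreover have "emeasure lborel ?T \<le> emeasure lborel {x \<in> cball 0 1 - {0}. x /\<^sub>R norm x \<in> S}"
    using Sb by (intro emeasure_mono) auto
  ultimately have "emeasure lborel {x \<in> cball 0 1 - {0}. x /\<^sub>R norm x \<in> S} \<noteq> 0" by auto
  then show "emeasure spherical_lebesgue (sphere 0 1 \<inter> S) > 0"
    using * by (simp add: spherical_lebesgue_eq_completion emeasure_spherical_borel[OF Sb] zero_less_iff_neq_zero)
qed

section \<open>Polytopes as irredundant intersections of half-spaces\<close>

text \<open>
  For bounded \<open>P\<close> the elements of \<open>A\<close> are the vertices of its polar body. The last condition says that no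
  inequality is redundant: \<open>w\<close> is a point in the relative interior of the facet with normal \<open>a\<close>.
\<close>

definition facet_system :: "'a::euclidean_space set \<Rightarrow> 'a set \<Rightarrow> bool" where
  "facet_system A P \<longleftrightarrow> finite A \<and> P = {x. \<forall>a\<in>A. a \<bullet> x \<le> 1} \<and>
     (\<forall>a\<in>A. \<exists>w. a \<bullet> w = 1 \<and> (\<forall>b\<in>A - {a}. b \<bullet> w < 1))"

lemma facet_systemD:
  assumes "facet_system A P"
  shows "finite A" "x \<in> P \<longleftrightarrow> (\<forall>a\<in>A. a \<bullet> x \<le> 1)"
  using assms by (auto simp: facet_system_def)

lemma facet_system_witness:
  assumes "facet_system A P" "a \<in> A"
  obtains w where "w \<in> P" "a \<bullet> w = 1" "\<And>b. b \<in> A - {a} \<Longrightarrow> b \<bullet> w < 1"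
proof -
  obtain w where w: "a \<bullet> w = 1" "\<forall>b\<in>A - {a}. b \<bullet> w < 1"
    using assms by (auto simp: facet_system_def)
  then have "w \<in> P" using facet_systemD(2)[OF assms(1), of w] by force
  then show thesis using w that by blast
qed

lemma facet_system_nonzero:
  assumes "facet_system A P" "a \<in> A"
  shows "a \<noteq> 0"
  using facet_system_witness[OF assms] by fastforce

text \<open>
  Of two parallel inequalities one would be redundant.
\<close>

lemma facet_system_direction_unique:
  assumes A: "facet_system A P" "a \<in> A" "t *\<^sub>R a \<in> A" "t > 0"
  shows "t = 1"
proof (rule ccontr)
  assume "t \<noteq> 1"
  then have ne: "t *\<^sub>R a \<noteq> a"
    using facet_system_nonzero[OF A(1,2)] scaleR_cancel_right[of t a 1] by auto
  obtain w where w: "a \<bullet> w = 1" "\<And>b. b \<in> A - {a} \<Longrightarrow> b \<bullet> w < 1"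
    using facet_system_witness[OF A(1,2)] by blast
  then have "t < 1" using w(2)[of "t *\<^sub>R a"] A(3) ne by simp
  obtain z where z: "(t *\<^sub>R a) \<bullet> z = 1" "\<And>b. b \<in> A - {t *\<^sub>R a} \<Longrightarrow> b \<bullet> z < 1"
    using facet_system_witness[OF A(1,3)] by blast
  then have "t * (a \<bullet> z) = 1" "a \<bullet> z < 1" using z(2)[of a] A(2) ne by auto
  moreover have "t * (a \<bullet> z) < 1 * 1"
  proof -
    have "t * (a \<bullet> z) < t * 1" using A(4) \<open>a \<bullet> z < 1\<close> by (intro mult_strict_left_mono)
    then show ?thesis using \<open>t < 1\<close> by simp
  qed
  ultimately show False by simp
qed

text \<open>
  Every defining half-space contains the origin in its interior and can therefore be normalised to
  \<open>c \<bullet> x \<le> 1\<close>. In a system with the least number of inequalities, dropping the one of \<open>a\<close> admits some \<open>y\<close>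
  with \<open>a \<bullet> y > 1\<close>, and rescaling \<open>y\<close> to the hyperplane \<open>a \<bullet> x = 1\<close> makes all other inequalities strict.
\<close>

lemma facet_system_exists:
  fixes P :: "'a::euclidean_space set"
  assumes "polytope P" "0 \<in> interior P"
  obtains A where "facet_system A P"
proof -
  let ?H = "\<lambda>A. {x. \<forall>a\<in>A. a \<bullet> x \<le> (1::real)}"
  have "polyhedron P" using assms(1) by (rule polytope_imp_polyhedron)
  then obtain F where F: "finite F" "P = \<Inter>F" "\<forall>h\<in>F. \<exists>a b. a \<noteq> 0 \<and> h = {x. a \<bullet> x \<le> b}"
    unfolding polyhedron_def by blast
  have "\<exists>c. \<forall>x. x \<in> h \<longleftrightarrow> c \<bullet> x \<le> 1" if h: "h \<in> F" for h
  proof -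
    obtain a b where ab: "a \<noteq> 0" "h = {x. a \<bullet> x \<le> b}" using F(3) h by blast
    have "0 \<in> interior h" using assms(2) F(2) h interior_mono[of P h] by blast
    then have b: "b > 0" using ab interior_halfspace_le[of a b] by simp
    then have "\<forall>x. x \<in> h \<longleftrightarrow> (a /\<^sub>R b) \<bullet> x \<le> 1" using ab(2) by (simp add: inverse_eq_divide)
    then show ?thesis by blast
  qed
  then obtain c where c: "\<And>h x. h \<in> F \<Longrightarrow> x \<in> h \<longleftrightarrow> c h \<bullet> x \<le> 1" by metis
  then have "P = ?H (c ` F)" unfolding F(2) by blast
  then have "finite (c ` F) \<and> P = ?H (c ` F)" using F(1) by blast
  then have "\<exists>A. (finite A \<and> P = ?H A) \<and> (\<forall>B. finite B \<and> P = ?H B \<longrightarrow> card A \<le> card B)"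
    by (rule ex_has_least_nat)
  then obtain A where A: "finite A" "P = ?H A" and least: "\<forall>B. finite B \<and> P = ?H B \<longrightarrow> card A \<le> card B"
    by (elim exE conjE)
  have "\<exists>w. a \<bullet> w = 1 \<and> (\<forall>b\<in>A - {a}. b \<bullet> w < 1)" if a: "a \<in> A" for a
  proof -
    have "card (A - {a}) < card A" using A(1) a by (rule card_Diff1_less)
    then have "\<not> (finite (A - {a}) \<and> P = ?H (A - {a}))"
      using least[THEN spec, of "A - {a}"] by linarith
    then have "P \<noteq> ?H (A - {a})" using A(1) by simp
    moreover have "P \<subseteq> ?H (A - {a})" unfolding A(2) by blast
    ultimately obtain y where y: "y \<notin> P" "\<forall>b\<in>A - {a}. b \<bullet> y \<le> 1" by blast
    then obtain b where "b \<in> A" "\<not> b \<bullet> y \<le> 1" unfolding A(2) by blast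
    then have ay: "a \<bullet> y > 1" using y(2) by (cases "b = a") auto
    have "b \<bullet> (y /\<^sub>R (a \<bullet> y)) < 1" if "b \<in> A - {a}" for b
    proof -
      have "b \<bullet> y \<le> 1" using y(2) that by blast
      then have "b \<bullet> y < a \<bullet> y" using ay by linarith
      then have "b \<bullet> y / (a \<bullet> y) < 1" using ay by (subst divide_less_eq_1_pos) auto
      then show ?thesis by (simp add: inverse_eq_divide)
    qed
    moreover have "a \<bullet> (y /\<^sub>R (a \<bullet> y)) = 1" using ay by simp
    ultimately show ?thesis by blast
  qed
  then have "facet_system A P" unfolding facet_system_def using A(1) by (intro conjI A(2) ballI)
  then show thesis by (rule that)
qed

lemma facet_system_scale:
  fixes P :: "'a::euclidean_space set"
  assumes A: "facet_system A P" and c: "c > 0"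
  shows "facet_system ((\<lambda>a. a /\<^sub>R c) ` A) ((*\<^sub>R) c ` P)"
proof -
  have "(*\<^sub>R) c ` P = {x. \<forall>a\<in>(\<lambda>a. a /\<^sub>R c) ` A. a \<bullet> x \<le> 1}"
  proof (rule set_eqI)
    fix x
    have "x \<in> (*\<^sub>R) c ` P \<longleftrightarrow> x /\<^sub>R c \<in> P"
      using c by (auto simp: image_iff intro!: bexI[of _ "x /\<^sub>R c"])
    then show "x \<in> (*\<^sub>R) c ` P \<longleftrightarrow> x \<in> {x. \<forall>a\<in>(\<lambda>a. a /\<^sub>R c) ` A. a \<bullet> x \<le> 1}"
      using facet_systemD(2)[OF A, of "x /\<^sub>R c"] by simp
  qed
  moreover have "\<exists>w. (a /\<^sub>R c) \<bullet> w = 1 \<and> (\<forall>b\<in>(\<lambda>a. a /\<^sub>R c) ` A - {a /\<^sub>R c}. b \<bullet> w < 1)" if aA: "a \<in> A" for a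
  proof -
    obtain w where "a \<bullet> w = 1" "\<And>b. b \<in> A - {a} \<Longrightarrow> b \<bullet> w < 1" using facet_system_witness[OF A aA] by metis
    moreover have "(b /\<^sub>R c) \<bullet> (c *\<^sub>R w) = b \<bullet> w" for b using c by simp
    ultimately have "(a /\<^sub>R c) \<bullet> (c *\<^sub>R w) = 1 \<and> (\<forall>b\<in>A. b /\<^sub>R c \<noteq> a /\<^sub>R c \<longrightarrow> (b /\<^sub>R c) \<bullet> (c *\<^sub>R w) < 1)"
      by (metis Diff_iff singletonD)
    then show ?thesis by blast
  qed
  ultimately show ?thesis using facet_systemD(1)[OF A] by (auto simp: facet_system_def)
qed

lemma open_strict_inequalities:
  fixes B :: "'a::euclidean_space set"
  assumes "finite B"
  shows "open {x. \<forall>b\<in>B. b \<bullet> x < (1::real)}"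
proof -
  have "{x. \<forall>b\<in>B. b \<bullet> x < (1::real)} = (\<Inter>b\<in>B. {x. b \<bullet> x < 1})" by auto
  then show ?thesis using assms by (simp add: open_INT open_halfspace_lt)
qed

lemma facet_system_strict_interior:
  fixes P :: "'a::euclidean_space set"
  assumes A: "facet_system A P" and x: "\<And>a. a \<in> A \<Longrightarrow> a \<bullet> x < 1"
  shows "x \<in> interior P"
proof (rule interiorI)
  show "open {x. \<forall>a\<in>A. a \<bullet> x < 1}" by (rule open_strict_inequalities[OF facet_systemD(1)[OF A]])
  show "{x. \<forall>a\<in>A. a \<bullet> x < 1} \<subseteq> P" using facet_systemD(2)[OF A] by force
qed (use x in auto)

lemma facet_system_zero_interior:
  fixes P :: "'a::euclidean_space set"
  assumes "facet_system A P"
  shows "0 \<in> interior P"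
  using facet_system_strict_interior[OF assms, of 0] by simp

lemma outer_unit_normal_facet:
  fixes P :: "(real ^ 'n) set"
  assumes A: "facet_system A P" and a: "a \<in> A" and x: "x \<in> P" "a \<bullet> x = 1"
  shows "is_outer_unit_normal P x (a /\<^sub>R norm a)"
proof -
  have "a \<noteq> 0" using A a by (rule facet_system_nonzero)
  moreover have "a \<bullet> y \<le> a \<bullet> x" if "y \<in> P" for y using facet_systemD(2)[OF A] a that x by auto
  ultimately show ?thesis using x by (auto simp: is_outer_unit_normal_def mult_left_mono)
qed

text \<open>
  From a relative interior point of a facet one can move a little in both directions \<open>d\<close> and \<open>- d\<close>
  within the facet hyperplane, so a normal vector is orthogonal to every \<open>d\<close> that is orthogonal to \<open>a\<close>.
\<close>

lemma outer_unit_normal_unique: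
  fixes P :: "(real ^ 'n) set"
  assumes A: "facet_system A P" and a: "a \<in> A" and x: "a \<bullet> x = 1" "\<And>b. b \<in> A - {a} \<Longrightarrow> b \<bullet> x < 1"
    and v: "is_outer_unit_normal P x v"
  shows "v = a /\<^sub>R norm a"
proof -
  let ?O = "{x. \<forall>b\<in>A - {a}. b \<bullet> x < 1}"
  have "open ?O" using facet_systemD(1)[OF A] by (intro open_strict_inequalities) auto
  then obtain e where e: "e > 0" "ball x e \<subseteq> ?O"
    using x(2) unfolding open_contains_ball by blast
  have v1: "norm v = 1" and vle: "\<And>y. y \<in> P \<Longrightarrow> v \<bullet> y \<le> v \<bullet> x" using v by (auto simp: is_outer_unit_normal_def)
  have le0: "v \<bullet> d \<le> 0" if d: "a \<bullet> d = 0" for d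
  proof (cases "d = 0")
    case False
    define t where "t = e / (2 * norm d)"
    have t: "t > 0" using e False by (simp add: t_def)
    have "x + t *\<^sub>R d \<in> ball x e" using e False by (simp add: t_def dist_norm)
    then have inO: "x + t *\<^sub>R d \<in> ?O" using e by blast
    have "x + t *\<^sub>R d \<in> P"
      unfolding facet_systemD(2)[OF A]
    proof
      fix b assume "b \<in> A"
      show "b \<bullet> (x + t *\<^sub>R d) \<le> 1"
      proof (cases "b = a")
        case True
        then show ?thesis using x(1) d by (simp add: inner_add_right)
      next
        case False
        then show ?thesis using inO \<open>b \<in> A\<close> by (simp add: less_imp_le)
      qed
    qed
    from vle[OF this] show ?thesis using t by (simp add: inner_add_right mult_le_0_iff)
  qed simp
  have a0: "a \<noteq> 0" using A a by (rule facet_system_nonzero)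
  define c where "c = (a \<bullet> v) / (a \<bullet> a)"
  have o: "a \<bullet> (v - c *\<^sub>R a) = 0" using a0 by (simp add: inner_diff_right c_def)
  have "v \<bullet> (v - c *\<^sub>R a) \<le> 0" by (rule le0[OF o])
  moreover have "v \<bullet> (- (v - c *\<^sub>R a)) \<le> 0" by (rule le0) (simp only: inner_minus_right o minus_zero)
  ultimately have "v \<bullet> (v - c *\<^sub>R a) = 0" by (simp only: inner_minus_right)
  then have "(v - c *\<^sub>R a) \<bullet> (v - c *\<^sub>R a) = 0"
    using o by (simp only: inner_diff_left inner_scaleR_left)
  then have vc: "v = c *\<^sub>R a" by simp
  have "0 \<in> P" using facet_systemD(2)[OF A] by simp
  from vle[OF this] have "c \<ge> 0" using vc x(1) by simp
  moreover have "\<bar>c\<bar> * norm a = 1" using v1 vc by simp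
  ultimately have "c = inverse (norm a)" using a0 by (simp add: field_simps)
  then show ?thesis using vc by simp
qed

lemma radial_properties:
  fixes K :: "(real ^ 'n) set"
  assumes K: "compact K" "0 \<in> interior K" and u: "norm u = 1"
  shows "radial K u > 0" "radial K u *\<^sub>R u \<in> K" "\<And>t. t *\<^sub>R u \<in> K \<Longrightarrow> t \<le> radial K u"
proof -
  let ?T = "{t. 0 \<le> t \<and> t *\<^sub>R u \<in> K}"
  obtain R where R: "\<And>x. x \<in> K \<Longrightarrow> norm x \<le> R"
    using compact_imp_bounded[OF K(1)] bounded_iff by blast
  have "closed ((\<lambda>t. t *\<^sub>R u) -` K)"
    using compact_imp_closed[OF K(1)] by (intro continuous_closed_vimage) (auto intro!: continuous_intros)
  moreover have "?T = {0..} \<inter> (\<lambda>t. t *\<^sub>R u) -` K" by auto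
  ultimately have "closed ?T" by (metis closed_Int closed_atLeast)
  moreover have "bounded ?T"
    unfolding bounded_iff using R u by (force intro!: exI[of _ R])
  moreover have "0 \<in> ?T" using K(2) interior_subset by auto
  ultimately obtain s where s: "s \<in> ?T" "\<And>t. t \<in> ?T \<Longrightarrow> t \<le> s"
    using compact_attains_sup[of ?T] compact_eq_bounded_closed by blast
  have rs: "radial K u = s" unfolding radial_def using s by (intro Greatest_equality) auto
  obtain r where r: "r > 0" "cball 0 r \<subseteq> K" using K(2) mem_interior_cball by blast
  then have "r \<in> ?T" using u by (auto simp: subset_eq)
  from s(2)[OF this] show "radial K u > 0" using r(1) rs by simp
  show "radial K u *\<^sub>R u \<in> K" using s rs by simp
  show "t \<le> radial K u" if "t *\<^sub>R u \<in> K" for t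
    using s that rs by (cases "t \<ge> 0") force+
qed

lemma radial_facet:
  fixes P :: "(real ^ 'n) set"
  assumes A: "facet_system A P" and P: "compact P" and u: "norm u = 1" and a: "a \<in> A" "a \<bullet> u > 0" "u /\<^sub>R (a \<bullet> u) \<in> P"
  shows "radial P u = inverse (a \<bullet> u)"
proof (rule antisym)
  note r = radial_properties[OF P facet_system_zero_interior[OF A] u]
  show "inverse (a \<bullet> u) \<le> radial P u" using r(3) a(3) by simp
  have "radial P u * (a \<bullet> u) \<le> 1" using facet_systemD(2)[OF A] r(2) a(1) by force
  then show "radial P u \<le> inverse (a \<bullet> u)" using a(2) by (simp add: field_simps)
qed

lemma radial_active:
  fixes P :: "(real ^ 'n) set"
  assumes A: "facet_system A P" and P: "compact P" and u: "norm u = 1"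
  obtains a where "a \<in> A" "a \<bullet> (radial P u *\<^sub>R u) = 1"
proof -
  note r = radial_properties[OF P facet_system_zero_interior[OF A] u]
  have "\<exists>a\<in>A. a \<bullet> (radial P u *\<^sub>R u) = 1"
  proof (rule ccontr)
    assume "\<not> ?thesis"
    then have "radial P u *\<^sub>R u \<in> interior P"
      using facet_systemD(2)[OF A] r(2) by (intro facet_system_strict_interior[OF A]) force
    then obtain e where e: "e > 0" "cball (radial P u *\<^sub>R u) e \<subseteq> P" using mem_interior_cball by blast
    have "(radial P u + e) *\<^sub>R u \<in> cball (radial P u *\<^sub>R u) e"
      using e u by (simp add: dist_norm scaleR_add_left)
    then have "(radial P u + e) *\<^sub>R u \<in> P" using e by blast
    from r(3)[OF this] show False using e by simp
  qed
  then show thesis using that by blast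
qed

lemma reverse_radial_gauss_image_facet:
  fixes P :: "(real ^ 'n) set"
  assumes A: "facet_system A P" and P: "compact P" and a: "a \<in> A"
  shows "reverse_radial_gauss_image P {a /\<^sub>R norm a} = {u \<in> sphere 0 1. a \<bullet> u > 0 \<and> u /\<^sub>R (a \<bullet> u) \<in> P}"
proof (rule set_eqI)
  fix u
  have a0: "a \<noteq> 0" using A a by (rule facet_system_nonzero)
  show "u \<in> reverse_radial_gauss_image P {a /\<^sub>R norm a} \<longleftrightarrow> u \<in> {u \<in> sphere 0 1. a \<bullet> u > 0 \<and> u /\<^sub>R (a \<bullet> u) \<in> P}"
  proof
    assume "u \<in> reverse_radial_gauss_image P {a /\<^sub>R norm a}"
    then have u: "norm u = 1" and v: "is_outer_unit_normal P (radial P u *\<^sub>R u) (a /\<^sub>R norm a)"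
      by (auto simp: reverse_radial_gauss_image_def)
    note r = radial_properties[OF P facet_system_zero_interior[OF A] u]
    obtain w where w: "w \<in> P" "a \<bullet> w = 1" using facet_system_witness[OF A a] by metis
    have "(a /\<^sub>R norm a) \<bullet> w \<le> (a /\<^sub>R norm a) \<bullet> (radial P u *\<^sub>R u)" 
      using v w(1) unfolding is_outer_unit_normal_def by blast
    then have "1 \<le> radial P u * (a \<bullet> u)" using w a0 by simp
    moreover have "radial P u * (a \<bullet> u) \<le> 1" using facet_systemD(2)[OF A] r(2) a by force
    ultimately have eq: "radial P u * (a \<bullet> u) = 1" by simp
    then have "a \<bullet> u > 0" using r(1) zero_less_mult_pos[of "radial P u" "a \<bullet> u"] by simp
    moreover from this eq have "radial P u = inverse (a \<bullet> u)" by (simp add: field_simps)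
    ultimately show "u \<in> {u \<in> sphere 0 1. a \<bullet> u > 0 \<and> u /\<^sub>R (a \<bullet> u) \<in> P}" using u r(2) by simp
  next
    assume "u \<in> {u \<in> sphere 0 1. a \<bullet> u > 0 \<and> u /\<^sub>R (a \<bullet> u) \<in> P}"
    then have u: "norm u = 1" "a \<bullet> u > 0" "u /\<^sub>R (a \<bullet> u) \<in> P" by auto
    have "a \<bullet> (u /\<^sub>R (a \<bullet> u)) = 1" using u(2) by simp
    from outer_unit_normal_facet[OF A a u(3) this]
    show "u \<in> reverse_radial_gauss_image P {a /\<^sub>R norm a}"
      using u radial_facet[OF A P u(1) a u(2,3)] by (auto simp: reverse_radial_gauss_image_def)
  qed
qed

section \<open>The curvature measure of a polytope\<close>

text \<open>
  The directions of the points of \<open>K\<close> in the hyperplane \<open>{x. a \<bullet> x = 1}\<close>; for a facet normal \<open>a\<close> of a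
  polytope this is a reverse radial Gauss image.
\<close>

definition facet_cone :: "(real ^ 'n) set \<Rightarrow> real ^ 'n \<Rightarrow> (real ^ 'n) set" where
  "facet_cone K a = {u \<in> sphere 0 1. a \<bullet> u > 0 \<and> u /\<^sub>R (a \<bullet> u) \<in> K}"

text \<open>
  The integrand of the curvature measure after the substitution of the radial function and of the unit
  normal on a facet; \<open>inverse (a \<bullet> u)\<close> is the radial function there.
\<close>

definition facet_density :: "real \<Rightarrow> nat \<Rightarrow> (real ^ 'n) set \<Rightarrow> real ^ 'n \<Rightarrow> real ^ 'n \<Rightarrow> real" where
  "facet_density p m K a u =
     norm a powr p * inverse (a \<bullet> u) ^ m * dual_radon m (\<lambda>L. section_volume K L ^ (CARD('n) - 1)) u"

lemma AE_spherical_lebesgue_norm: "AE u in spherical_lebesgue. norm u = 1"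
  by (rule AE_I2) (simp add: spherical_lebesgue_eq_completion space_spherical_borel)

text \<open>
  If the numbers \<open>a \<bullet> u\<close> for \<open>a \<in> A\<close> are distinct, only one of the inequalities \<open>a \<bullet> x \<le> 1\<close> is active where the ray in
  direction \<open>u\<close> leaves the polytope: almost every ray leaves it through the relative interior of a facet.
\<close>

lemma AE_spherical_lebesgue_generic:
  fixes A :: "(real ^ 'n) set"
  assumes "finite A"
  shows "AE u in spherical_lebesgue. norm u = 1 \<and> (\<forall>a\<in>A. \<forall>b\<in>A. a \<noteq> b \<longrightarrow> a \<bullet> u \<noteq> b \<bullet> u)"
proof -
  have "AE u in spherical_lebesgue. a \<noteq> b \<longrightarrow> a \<bullet> u \<noteq> b \<bullet> u" for a b :: "real ^ 'n"
  proof (cases "a = b")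
    case False
    then have "AE u in spherical_lebesgue. (a - b) \<bullet> u \<noteq> 0" by (intro AE_spherical_lebesgue_not_orthogonal) simp
    then show ?thesis by (rule AE_mp) (auto simp: inner_diff_left)
  qed simp
  then have "AE u in spherical_lebesgue. \<forall>a\<in>A. \<forall>b\<in>A. a \<noteq> b \<longrightarrow> a \<bullet> u \<noteq> b \<bullet> u"
    using assms by (intro AE_finite_allI)
  then show ?thesis using AE_spherical_lebesgue_norm by (rule AE_conjI[rotated])
qed

text \<open>
  Almost every direction of the facet belongs to a relative interior point, where \<open>a / |a|\<close> is the only
  outer unit normal. Substituting it and the radial function turns the integrand into the density.
\<close>

lemma affine_dual_curvature_facet:
  fixes P :: "(real ^ 'n) set"
  assumes A: "facet_system A P" and P: "compact P" and a: "a \<in> A"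
  shows "affine_dual_curvature p m P {a /\<^sub>R norm a}
    = (\<integral>\<^sup>+u. ennreal (facet_density p m P a u) * indicator (facet_cone P a) u \<partial>spherical_lebesgue)"
  unfolding affine_dual_curvature_def reverse_radial_gauss_image_facet[OF A P a] facet_cone_def[symmetric]
proof (rule nn_integral_cong_AE)
  let ?R = "dual_radon m (\<lambda>L. section_volume P L ^ (CARD('n) - 1))"
  show "AE u in spherical_lebesgue.
      ennreal ((u \<bullet> outer_unit_normal P (radial P u *\<^sub>R u)) powr (- p) * radial P u powr (real m - p) * ?R u) * indicator (facet_cone P a) u
    = ennreal (facet_density p m P a u) * indicator (facet_cone P a) u"
    using AE_spherical_lebesgue_generic[OF facet_systemD(1)[OF A]]
  proof (rule AE_mp, intro AE_I2 impI)
    fix u assume gen: "norm u = 1 \<and> (\<forall>a\<in>A. \<forall>b\<in>A. a \<noteq> b \<longrightarrow> a \<bullet> u \<noteq> b \<bullet> u)"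
    show "ennreal ((u \<bullet> outer_unit_normal P (radial P u *\<^sub>R u)) powr (- p) * radial P u powr (real m - p) * ?R u) * indicator (facet_cone P a) u
      = ennreal (facet_density p m P a u) * indicator (facet_cone P a) u"
    proof (cases "u \<in> facet_cone P a")
      case True
      then have u: "norm u = 1" "a \<bullet> u > 0" "u /\<^sub>R (a \<bullet> u) \<in> P" by (auto simp: facet_cone_def)
      have a0: "norm a > 0" using facet_system_nonzero[OF A a] by simp
      have rad: "radial P u = inverse (a \<bullet> u)" by (rule radial_facet[OF A P u(1) a u(2,3)])
      let ?x = "u /\<^sub>R (a \<bullet> u)"
      have x1: "a \<bullet> ?x = 1" using u(2) by simp
      have xb: "b \<bullet> ?x < 1" if b: "b \<in> A - {a}" for b
      proof -
        have "b \<bullet> ?x \<le> 1" using facet_systemD(2)[OF A, of ?x] u(3) b by blast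
        then have "b \<bullet> u \<le> a \<bullet> u" using u(2) by (simp add: field_simps)
        then have "b \<bullet> u < a \<bullet> u" using gen a b by force
        then show ?thesis using u(2) by (simp add: field_simps)
      qed
      have "outer_unit_normal P ?x = a /\<^sub>R norm a"
        unfolding outer_unit_normal_def
        using outer_unit_normal_facet[OF A a u(3) x1] outer_unit_normal_unique[OF A a x1 xb]
        by (rule the_equality)
      then have "(u \<bullet> outer_unit_normal P (radial P u *\<^sub>R u)) = (a \<bullet> u) / norm a"
        by (simp add: rad inner_commute divide_inverse mult.commute)
      then have "(u \<bullet> outer_unit_normal P (radial P u *\<^sub>R u)) powr (- p) * radial P u powr (real m - p)
          = ((a \<bullet> u) / norm a) powr (- p) * (a \<bullet> u) powr (p - real m)"
        using u(2) powr_minus[of "a \<bullet> u" "real m - p"] inverse_powr[of "a \<bullet> u" "real m - p"] by (simp add: rad)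
      also have "\<dots> = norm a powr p * ((a \<bullet> u) powr (- p) * (a \<bullet> u) powr (p - real m))"
        using u(2) a0 by (simp add: powr_divide powr_minus divide_simps)
      also have "(a \<bullet> u) powr (- p) * (a \<bullet> u) powr (p - real m) = (a \<bullet> u) powr (- real m)"
        by (simp add: powr_add[symmetric])
      also have "(a \<bullet> u) powr (- real m) = inverse (a \<bullet> u) ^ m"
        using u(2) by (simp add: powr_minus powr_realpow power_inverse)
      finally show ?thesis by (simp add: facet_density_def)
    qed simp
  qed
qed

text \<open>
  At a relative interior point of a facet there are no other unit normals than that of the facet.
\<close>

lemma affine_dual_curvature_not_facet_normal:
  fixes P :: "(real ^ 'n) set"
  assumes A: "facet_system A P" and P: "compact P" and v: "\<And>a. a \<in> A \<Longrightarrow> v \<noteq> a /\<^sub>R norm a"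
  shows "affine_dual_curvature p m P {v} = 0"
proof -
  have "AE u in spherical_lebesgue. u \<notin> reverse_radial_gauss_image P {v}"
    using AE_spherical_lebesgue_generic[OF facet_systemD(1)[OF A]]
  proof (rule AE_mp, intro AE_I2 impI notI)
    fix u assume gen: "norm u = 1 \<and> (\<forall>a\<in>A. \<forall>b\<in>A. a \<noteq> b \<longrightarrow> a \<bullet> u \<noteq> b \<bullet> u)"
      and "u \<in> reverse_radial_gauss_image P {v}"
    then have u: "norm u = 1" and n: "is_outer_unit_normal P (radial P u *\<^sub>R u) v"
      by (auto simp: reverse_radial_gauss_image_def)
    note r = radial_properties[OF P facet_system_zero_interior[OF A] u]
    obtain a where a: "a \<in> A" "a \<bullet> (radial P u *\<^sub>R u) = 1" using radial_active[OF A P u] .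
    have "b \<bullet> (radial P u *\<^sub>R u) < 1" if b: "b \<in> A - {a}" for b
    proof -
      have "b \<bullet> (radial P u *\<^sub>R u) \<le> 1" using facet_systemD(2)[OF A] r(2) b by blast
      moreover have "b \<bullet> u \<noteq> a \<bullet> u" using gen a b by blast
      then have "b \<bullet> (radial P u *\<^sub>R u) \<noteq> a \<bullet> (radial P u *\<^sub>R u)" using r(1) by simp
      ultimately show ?thesis using a(2) by linarith
    qed
    from outer_unit_normal_unique[OF A a this n] v[OF a(1)] show False by simp
  qed
  then have "affine_dual_curvature p m P {v} = (\<integral>\<^sup>+u. 0 \<partial>(spherical_lebesgue :: (real ^ 'n) measure))"
    unfolding affine_dual_curvature_def
    by (intro nn_integral_cong_AE, elim AE_mp) (auto intro!: AE_I2)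
  then show ?thesis by simp
qed

text \<open>
  Uniform bounds, which give positivity and finiteness of the mass of a facet. From below one uses
  \<open>a \<bullet> u \<le> |a|\<close>, and from above that \<open>inverse (a \<bullet> u)\<close> is the norm of a point of the bounded set \<open>K\<close>.
\<close>

lemma facet_density_bounds:
  fixes K :: "(real ^ 'n) set"
  assumes K: "compact K" "0 \<in> interior K" and m: "1 \<le> m" "m \<le> CARD('n)" and a: "a \<noteq> 0"
  obtains lo hi where "0 < lo" and
    "\<And>u. norm u = 1 \<Longrightarrow> a \<bullet> u > 0 \<Longrightarrow> lo \<le> facet_density p m K a u" and
    "\<And>u. u \<in> facet_cone K a \<Longrightarrow> facet_density p m K a u \<le> hi"
proof -
  let ?R = "dual_radon m (\<lambda>L. section_volume K L ^ (CARD('n) - 1))"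
  obtain lo hi where lo: "0 < lo" and b: "\<And>u. norm u = 1 \<Longrightarrow> lo \<le> ?R u \<and> ?R u \<le> hi"
    using dual_radon_section_bounds[OF K m] by metis
  obtain r where r: "\<And>x. x \<in> K \<Longrightarrow> norm x \<le> r"
    using compact_imp_bounded[OF K(1)] bounded_iff by blast
  have na: "norm a > 0" using a by simp
  show thesis
  proof (rule that[of "norm a powr p * inverse (norm a) ^ m * lo" "norm a powr p * r ^ m * hi"])
    show "0 < norm a powr p * inverse (norm a) ^ m * lo" using na lo by simp
    fix u assume u: "norm u = 1" "a \<bullet> u > 0"
    have "a \<bullet> u \<le> norm a" using norm_cauchy_schwarz[of a u] u(1) by simp
    then have "inverse (norm a) ^ m \<le> inverse (a \<bullet> u) ^ m"
      using u(2) by (intro power_mono le_imp_inverse_le) auto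
    then show "norm a powr p * inverse (norm a) ^ m * lo \<le> facet_density p m K a u"
      unfolding facet_density_def using b[OF u(1)] lo u(2) by (intro mult_mono mult_left_mono) auto
  next
    fix u assume "u \<in> facet_cone K a"
    then have u: "norm u = 1" "a \<bullet> u > 0" "u /\<^sub>R (a \<bullet> u) \<in> K" by (auto simp: facet_cone_def)
    have "inverse (a \<bullet> u) \<le> r" using r[OF u(3)] u(1,2) by simp
    then have "inverse (a \<bullet> u) ^ m \<le> r ^ m" using u(2) by (intro power_mono) auto
    moreover have "0 \<le> r" using r[OF u(3)] norm_ge_zero order_trans by blast
    ultimately show "facet_density p m K a u \<le> norm a powr p * r ^ m * hi"
      unfolding facet_density_def using b[OF u(1)] lo u(2) by (intro mult_mono mult_left_mono) auto
  qed
qed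

lemma open_cone_over_facet:
  fixes B :: "'a::euclidean_space set"
  assumes "finite B"
  shows "open {u. a \<bullet> u > 0 \<and> (\<forall>b\<in>B. b \<bullet> u < a \<bullet> u)}"
proof -
  have "{u. a \<bullet> u > 0 \<and> (\<forall>b\<in>B. b \<bullet> u < a \<bullet> u)} = {u. a \<bullet> u > 0} \<inter> (\<Inter>b\<in>B. {u. (b - a) \<bullet> u < 0})"
    by (auto simp: inner_diff_left)
  then show ?thesis using assms by (simp add: open_INT open_Int open_halfspace_lt open_halfspace_gt)
qed

lemma cone_over_facet_subset:
  fixes P :: "(real ^ 'n) set"
  assumes A: "facet_system A P" and u: "norm u = 1" "a \<bullet> u > 0" "\<forall>b\<in>A - {a}. b \<bullet> u < a \<bullet> u"
  shows "u \<in> facet_cone P a"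
proof -
  have "b \<bullet> (u /\<^sub>R (a \<bullet> u)) \<le> 1" if "b \<in> A" for b
  proof (cases "b = a")
    case False
    then have "b \<bullet> u < a \<bullet> u" using u(3) that by blast
    then show ?thesis using u(2) by (simp add: field_simps)
  qed (use u in simp)
  then show ?thesis using u facet_systemD(2)[OF A] by (auto simp: facet_cone_def)
qed

lemma affine_dual_curvature_facet_finite:
  fixes P :: "(real ^ 'n) set"
  assumes A: "facet_system A P" and P: "compact P" and a: "a \<in> A" and m: "1 \<le> m" "m \<le> CARD('n)"
  shows "affine_dual_curvature p m P {a /\<^sub>R norm a} < \<infinity>"
proof -
  obtain hi where hi: "\<And>u. u \<in> facet_cone P a \<Longrightarrow> facet_density p m P a u \<le> hi"
    using facet_density_bounds[OF P facet_system_zero_interior[OF A] m facet_system_nonzero[OF A a]] by metis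
  have "affine_dual_curvature p m P {a /\<^sub>R norm a} \<le> (\<integral>\<^sup>+u. ennreal hi \<partial>(spherical_lebesgue :: (real ^ 'n) measure))"
    unfolding affine_dual_curvature_facet[OF A P a]
    by (intro nn_integral_mono) (auto simp: indicator_def hi ennreal_leI)
  also have "\<dots> = ennreal hi * emeasure spherical_lebesgue (sphere 0 1 :: (real ^ 'n) set)"
    by (simp add: spherical_lebesgue_eq_completion space_spherical_borel)
  also have "\<dots> < \<infinity>"
    using emeasure_spherical_lebesgue_finite[where 'n = 'n] by (simp add: ennreal_mult_less_top)
  finally show ?thesis .
qed

text \<open>
  Both the facet and the density grow with the body. If a point \<open>x\<close> of the facet of \<open>P\<close> is missing in
  \<open>Q\<close>, then so are nearby relative interior points of this facet; their directions contain a nonempty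
  open subset of the sphere that contributes to the mass for \<open>P\<close> but not to the one for \<open>Q\<close>.
\<close>

lemma affine_dual_curvature_facet_strict_mono:
  fixes Q P :: "(real ^ 'n) set"
  assumes B: "facet_system B Q" and Q: "compact Q"
    and A: "facet_system A P" and P: "compact P"
    and sub: "Q \<subseteq> P" and a: "a \<in> A" "a \<in> B" and m: "1 \<le> m" "m \<le> CARD('n)"
  shows "affine_dual_curvature p m Q {a /\<^sub>R norm a} \<le> affine_dual_curvature p m P {a /\<^sub>R norm a}"
    and "x \<in> P \<Longrightarrow> a \<bullet> x = 1 \<Longrightarrow> x \<notin> Q \<Longrightarrow>
      affine_dual_curvature p m Q {a /\<^sub>R norm a} < affine_dual_curvature p m P {a /\<^sub>R norm a}"
proof -
  let ?fQ = "\<lambda>u. ennreal (facet_density p m Q a u) * indicator (facet_cone Q a) u"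
  let ?fP = "\<lambda>u. ennreal (facet_density p m P a u) * indicator (facet_cone P a) u"
  have cone: "facet_cone Q a \<subseteq> facet_cone P a" using sub by (auto simp: facet_cone_def)
  have dens: "facet_density p m Q a u \<le> facet_density p m P a u" if u: "norm u = 1" "a \<bullet> u > 0" for u
    unfolding facet_density_def
    using dual_radon_section_mono[OF u(1) m Q P sub] u(2) by (intro mult_left_mono) auto
  have le: "?fQ u \<le> ?fP u" for u
    using cone dens by (auto simp: indicator_def facet_cone_def ennreal_leI)
  show "affine_dual_curvature p m Q {a /\<^sub>R norm a} \<le> affine_dual_curvature p m P {a /\<^sub>R norm a}"
    unfolding affine_dual_curvature_facet[OF B Q a(2)] affine_dual_curvature_facet[OF A P a(1)]
    by (rule nn_integral_mono) (rule le)
  assume x: "x \<in> P" "a \<bullet> x = 1" "x \<notin> Q"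
  obtain w where w: "w \<in> P" "a \<bullet> w = 1" "\<And>b. b \<in> A - {a} \<Longrightarrow> b \<bullet> w < 1" using facet_system_witness[OF A a(1)] by blast
  have opQ: "open (- Q)" using compact_imp_closed[OF Q] by blast
  \<comment> \<open>Move \<open>x\<close> slightly towards the relative interior point \<open>w\<close> of the facet without reaching \<open>Q\<close>.\<close>
  obtain t where t: "0 < t" "t < 1" "x + t *\<^sub>R (w - x) \<notin> Q"
  proof -
    have "((\<lambda>t. x + t *\<^sub>R (w - x)) \<longlongrightarrow> x + 0 *\<^sub>R (w - x)) (at_right 0)"
      by (intro tendsto_intros)
    then have "eventually (\<lambda>t. x + t *\<^sub>R (w - x) \<in> - Q) (at_right 0)"
      using opQ x(3) by (intro topological_tendstoD) auto
    moreover have "eventually (\<lambda>t. t \<in> {0<..<1::real}) (at_right 0)"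
      by (rule eventually_at_right_real) simp
    ultimately have "eventually (\<lambda>t. x + t *\<^sub>R (w - x) \<in> - Q \<and> t \<in> {0<..<1::real}) (at_right 0)"
      by (rule eventually_conj)
    then obtain t where "x + t *\<^sub>R (w - x) \<in> - Q \<and> t \<in> {0<..<1::real}"
      using eventually_happens'[OF trivial_limit_at_right_real] by blast
    then show thesis using that[of t] by auto
  qed
  let ?y = "x + t *\<^sub>R (w - x)"
  have y1: "a \<bullet> ?y = 1" using x(2) w(2) by (simp add: inner_add_right inner_diff_right)
  have yb: "b \<bullet> ?y < 1" if b: "b \<in> A - {a}" for b
  proof -
    have "b \<bullet> ?y = (1 - t) * (b \<bullet> x) + t * (b \<bullet> w)" by (simp add: inner_add_right inner_diff_right algebra_simps)
    also have "\<dots> < (1 - t) * 1 + t * 1"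
      using facet_systemD(2)[OF A, of x] x(1) b w(3)[OF b] t
      by (intro add_le_less_mono mult_left_mono mult_strict_left_mono) auto
    finally show ?thesis by simp
  qed
  \<comment> \<open>The open cone of the directions that leave \<open>P\<close> through the relative interior of the facet, outside \<open>Q\<close>.\<close>
  define S where "S = {u. a \<bullet> u > 0 \<and> (\<forall>b\<in>A - {a}. b \<bullet> u < a \<bullet> u)} \<inter> (\<lambda>u. u /\<^sub>R (a \<bullet> u)) -` (- Q)"
  have "continuous_on {u. a \<bullet> u > 0 \<and> (\<forall>b\<in>A - {a}. b \<bullet> u < a \<bullet> u)} (\<lambda>u. u /\<^sub>R (a \<bullet> u))"
    by (intro continuous_intros) auto
  then have S: "open S"
    unfolding S_def using opQ facet_systemD(1)[OF A] by (intro continuous_open_preimage open_cone_over_facet) auto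
  have y0: "norm ?y > 0" using y1 by force
  have yS: "?y /\<^sub>R norm ?y \<in> S"
  proof -
    have "(?y /\<^sub>R norm ?y) /\<^sub>R (a \<bullet> (?y /\<^sub>R norm ?y)) = ?y"
      unfolding inner_scaleR_right y1 using y0 by simp
    moreover have "a \<bullet> (?y /\<^sub>R norm ?y) > 0" unfolding inner_scaleR_right y1 using y0 by simp
    moreover have "b \<bullet> (?y /\<^sub>R norm ?y) < a \<bullet> (?y /\<^sub>R norm ?y)" if "b \<in> A - {a}" for b
      unfolding inner_scaleR_right y1 using y0 yb[OF that] by (intro mult_strict_left_mono) auto
    ultimately show ?thesis unfolding S_def using t(3) by auto
  qed
  have SP: "sphere 0 1 \<inter> S \<subseteq> facet_cone P a"
    using cone_over_facet_subset[OF A] by (auto simp: S_def)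
  have SQ: "u \<notin> facet_cone Q a" if "u \<in> S" for u using that by (auto simp: S_def facet_cone_def)
  obtain lo where lo: "lo > 0" "\<And>u. norm u = 1 \<Longrightarrow> a \<bullet> u > 0 \<Longrightarrow> lo \<le> facet_density p m P a u"
    using facet_density_bounds[OF P facet_system_zero_interior[OF A] m facet_system_nonzero[OF A a(1)]] by metis
  let ?h = "\<lambda>u. ennreal lo * indicator (sphere 0 1 \<inter> S) u"
  have Smeas: "sphere 0 1 \<inter> S \<in> sets spherical_lebesgue" and Spos: "emeasure spherical_lebesgue (sphere 0 1 \<inter> S) > 0"
    using emeasure_spherical_lebesgue_open_pos[OF S yS] y0 by simp_all
  have "?fQ u + ?h u \<le> ?fP u" for u
  proof (cases "u \<in> sphere 0 1 \<inter> S")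
    case True
    then show ?thesis using SP SQ lo(2)[of u] by (auto simp: indicator_def S_def ennreal_leI)
  next
    case False
    then show ?thesis using le[of u] by simp
  qed
  then have "(\<integral>\<^sup>+u. ?fQ u + ?h u \<partial>spherical_lebesgue) \<le> (\<integral>\<^sup>+u. ?fP u \<partial>spherical_lebesgue)"
    by (rule nn_integral_mono)
  moreover have "(\<integral>\<^sup>+u. ?fQ u \<partial>spherical_lebesgue) + (\<integral>\<^sup>+u. ?h u \<partial>spherical_lebesgue) \<le> (\<integral>\<^sup>+u. ?fQ u + ?h u \<partial>spherical_lebesgue)"
    using Smeas by (intro nn_integral_add_le_arbitrary) auto
  moreover have "(\<integral>\<^sup>+u. ?h u \<partial>spherical_lebesgue) = ennreal lo * emeasure spherical_lebesgue (sphere 0 1 \<inter> S)"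
    using Smeas by (simp add: nn_integral_cmult_indicator)
  ultimately have "affine_dual_curvature p m Q {a /\<^sub>R norm a} + ennreal lo * emeasure spherical_lebesgue (sphere 0 1 \<inter> S)
      \<le> affine_dual_curvature p m P {a /\<^sub>R norm a}"
    unfolding affine_dual_curvature_facet[OF B Q a(2)] affine_dual_curvature_facet[OF A P a(1)] by (simp only: order_trans)
  moreover have "ennreal lo * emeasure spherical_lebesgue (sphere 0 1 \<inter> S) > 0"
    using lo(1) Spos by (simp add: ennreal_zero_less_mult_iff)
  moreover have "affine_dual_curvature p m Q {a /\<^sub>R norm a} < \<infinity>"
    by (rule affine_dual_curvature_facet_finite[OF B Q a(2) m])
  ultimately have "affine_dual_curvature p m Q {a /\<^sub>R norm a} + 0
      < affine_dual_curvature p m Q {a /\<^sub>R norm a} + ennreal lo * emeasure spherical_lebesgue (sphere 0 1 \<inter> S)"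
    unfolding ennreal_add_left_cancel_less by auto
  also have "\<dots> \<le> affine_dual_curvature p m P {a /\<^sub>R norm a}" by fact
  finally show "affine_dual_curvature p m Q {a /\<^sub>R norm a} < affine_dual_curvature p m P {a /\<^sub>R norm a}" by simp
qed

lemma affine_dual_curvature_facet_pos:
  fixes P :: "(real ^ 'n) set"
  assumes A: "facet_system A P" and P: "compact P" and a: "a \<in> A" and m: "1 \<le> m" "m \<le> CARD('n)"
  shows "affine_dual_curvature p m P {a /\<^sub>R norm a} > 0"
proof -
  obtain w where w: "w \<in> P" "a \<bullet> w = 1" "\<And>b. b \<in> A - {a} \<Longrightarrow> b \<bullet> w < 1" using facet_system_witness[OF A a] by blast
  let ?S = "{u. a \<bullet> u > 0 \<and> (\<forall>b\<in>A - {a}. b \<bullet> u < a \<bullet> u)}"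
  have S: "open ?S" using facet_systemD(1)[OF A] by (intro open_cone_over_facet) simp
  have w0: "norm w > 0" using w(2) by force
  have wS: "w /\<^sub>R norm w \<in> ?S"
  proof -
    have "b \<bullet> (w /\<^sub>R norm w) < a \<bullet> (w /\<^sub>R norm w)" if "b \<in> A - {a}" for b
      unfolding inner_scaleR_right w(2) using w0 w(3)[OF that] by (intro mult_strict_left_mono) auto
    then show ?thesis using w0 w(2) by simp
  qed
  have Smeas: "sphere 0 1 \<inter> ?S \<in> sets spherical_lebesgue" and Spos: "emeasure spherical_lebesgue (sphere 0 1 \<inter> ?S) > 0"
    using emeasure_spherical_lebesgue_open_pos[OF S wS] w0 by simp_all
  obtain lo where lo: "lo > 0" "\<And>u. norm u = 1 \<Longrightarrow> a \<bullet> u > 0 \<Longrightarrow> lo \<le> facet_density p m P a u"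
    using facet_density_bounds[OF P facet_system_zero_interior[OF A] m facet_system_nonzero[OF A a]] by metis
  have "0 < ennreal lo * emeasure spherical_lebesgue (sphere 0 1 \<inter> ?S)"
    using lo(1) Spos by (simp add: ennreal_zero_less_mult_iff)
  also have "\<dots> = (\<integral>\<^sup>+u. ennreal lo * indicator (sphere 0 1 \<inter> ?S) u \<partial>spherical_lebesgue)"
    using Smeas by (simp add: nn_integral_cmult_indicator)
  also have "\<dots> \<le> affine_dual_curvature p m P {a /\<^sub>R norm a}"
    unfolding affine_dual_curvature_facet[OF A P a]
    using cone_over_facet_subset[OF A] lo(2) by (intro nn_integral_mono) (auto simp: indicator_def ennreal_leI)
  finally show ?thesis .
qed

text \<open>
  Dilation divides \<open>a\<close> by \<open>c\<close> and keeps the directions of the facet. The three factors of the density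
  contribute the exponents \<open>- p\<close>, \<open>m\<close> and \<open>m (n - 1)\<close>.
\<close>

lemma affine_dual_curvature_facet_scale:
  fixes P :: "(real ^ 'n) set"
  assumes A: "facet_system A P" and P: "compact P" and a: "a \<in> A" and c: "c > 0" and m: "1 \<le> m" "m \<le> CARD('n)"
  shows "affine_dual_curvature p m ((*\<^sub>R) c ` P) {a /\<^sub>R norm a}
    = ennreal (c powr (real (m * CARD('n)) - p)) * affine_dual_curvature p m P {a /\<^sub>R norm a}"
proof -
  let ?a = "a /\<^sub>R c"
  have A': "facet_system ((\<lambda>a. a /\<^sub>R c) ` A) ((*\<^sub>R) c ` P)" by (rule facet_system_scale[OF A c])
  have P': "compact ((*\<^sub>R) c ` P)" using P by (rule compact_scaling)
  have dir: "?a /\<^sub>R norm ?a = a /\<^sub>R norm a" using c by simp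
  have cone: "facet_cone ((*\<^sub>R) c ` P) ?a = facet_cone P a"
  proof -
    have "u /\<^sub>R (?a \<bullet> u) \<in> (*\<^sub>R) c ` P \<longleftrightarrow> u /\<^sub>R (a \<bullet> u) \<in> P" if "a \<bullet> u > 0" for u
    proof -
      have "u /\<^sub>R (?a \<bullet> u) = c *\<^sub>R (u /\<^sub>R (a \<bullet> u))" using c by simp
      moreover have "c *\<^sub>R z \<in> (*\<^sub>R) c ` P \<longleftrightarrow> z \<in> P" for z using c by auto
      ultimately show ?thesis by (simp only:)
    qed
    then show ?thesis using c by (auto simp: facet_cone_def zero_less_mult_iff)
  qed
  have card: "m + m * (CARD('n) - 1) = m * CARD('n)"
    using zero_less_card_finite[where 'a = 'n] by (cases "CARD('n)") auto
  have dens: "facet_density p m ((*\<^sub>R) c ` P) ?a u = c powr (real (m * CARD('n)) - p) * facet_density p m P a u"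
    if u: "norm u = 1" for u
  proof -
    have e1: "norm ?a powr p = c powr (- p) * norm a powr p"
      using c by (simp add: powr_mult powr_minus inverse_powr)
    have e2: "inverse (?a \<bullet> u) ^ m = c ^ m * inverse (a \<bullet> u) ^ m"
      using c by (simp add: power_mult_distrib)
    have "c ^ m * c ^ (m * (CARD('n) - 1)) = c powr real (m * CARD('n))"
      unfolding power_add[symmetric] card using c by (simp only: powr_realpow)
    then have e3: "c powr (real (m * CARD('n)) - p) = c powr (- p) * (c ^ m * c ^ (m * (CARD('n) - 1)))"
      by (simp only: powr_add[symmetric]) (simp only: diff_conv_add_uminus add.commute)
    show ?thesis
      unfolding facet_density_def dual_radon_section_scale[OF u m P c] e1 e2 e3 by (simp only: mult_ac)
  qed
  have "affine_dual_curvature p m ((*\<^sub>R) c ` P) {a /\<^sub>R norm a}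
      = (\<integral>\<^sup>+u. ennreal (facet_density p m ((*\<^sub>R) c ` P) ?a u) * indicator (facet_cone P a) u \<partial>spherical_lebesgue)"
    using affine_dual_curvature_facet[OF A' P', of ?a p m] a unfolding dir cone by blast
  also have "\<dots> = (\<integral>\<^sup>+u. ennreal (c powr (real (m * CARD('n)) - p)) * (ennreal (facet_density p m P a u) * indicator (facet_cone P a) u) \<partial>spherical_lebesgue)"
    using dens by (intro nn_integral_cong) (auto simp: indicator_def facet_cone_def ennreal_mult')
  also have "\<dots> = ennreal (c powr (real (m * CARD('n)) - p)) * affine_dual_curvature p m P {a /\<^sub>R norm a}"
    unfolding affine_dual_curvature_facet[OF A P a] using c by (intro nn_integral_cmult_arbitrary) simp
  finally show ?thesis .
qed

section \<open>Comparing two polytopes with the same curvature measure\<close>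

text \<open>
  The facet normals are exactly the atoms of the measure.
\<close>

lemma same_facet_normals:
  fixes P P' :: "(real ^ 'n) set"
  assumes A: "facet_system A P" and P: "compact P"
    and A': "facet_system A' P'" and P': "compact P'"
    and m: "1 \<le> m" "m \<le> CARD('n)"
    and eq: "\<And>v. norm v = 1 \<Longrightarrow> affine_dual_curvature p m P {v} = affine_dual_curvature p m P' {v}"
    and a: "a \<in> A"
  shows "\<exists>t>0. t *\<^sub>R a \<in> A'"
proof -
  have a0: "norm a > 0" using facet_system_nonzero[OF A a] by simp
  have "affine_dual_curvature p m P' {a /\<^sub>R norm a} \<noteq> 0"
    using affine_dual_curvature_facet_pos[OF A P a m, of p] eq[of "a /\<^sub>R norm a"] a0 by simp
  then obtain b where b: "b \<in> A'" "a /\<^sub>R norm a = b /\<^sub>R norm b"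
    using affine_dual_curvature_not_facet_normal[OF A' P'] by metis
  have "norm b > 0" using facet_system_nonzero[OF A' b(1)] by simp
  moreover from this have "b = (norm b / norm a) *\<^sub>R a"
    using arg_cong[OF b(2), of "\<lambda>x. norm b *\<^sub>R x"] by (simp add: divide_inverse)
  ultimately show ?thesis using a0 b(1) by (metis divide_pos_pos)
qed

text \<open>
  Let \<open>t a\<close> be the factor that takes \<open>a \<in> A\<close> to the parallel element of \<open>A'\<close>, that is, the quotient of
  the support numbers of \<open>P\<close> and \<open>P'\<close>. The dilate by the least quotient \<open>1 / t a\<close> of the support numbers
  of \<open>P'\<close> and \<open>P\<close> is contained in \<open>P'\<close> and touches it in the corresponding facet hyperplane.
\<close>

lemma dilate_touching_from_inside:
  fixes P P' :: "'a::euclidean_space set"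
  assumes A: "facet_system A P" and A': "facet_system A' P'" and ne: "A \<noteq> {}"
    and fwd: "\<And>a. a \<in> A \<Longrightarrow> \<exists>t>0. t *\<^sub>R a \<in> A'"
    and bwd: "\<And>b. b \<in> A' \<Longrightarrow> \<exists>t>0. t *\<^sub>R b \<in> A"
  obtains c a where "c > 0" "a \<in> A" "a /\<^sub>R c \<in> A'" "(*\<^sub>R) c ` P \<subseteq> P'"
proof -
  obtain t where t: "\<And>a. a \<in> A \<Longrightarrow> t a > 0 \<and> t a *\<^sub>R a \<in> A'" using fwd by metis
  have fin: "finite A" using facet_systemD(1)[OF A] .
  obtain a where a: "a \<in> A" "\<And>b. b \<in> A \<Longrightarrow> t b \<le> t a"
  proof -
    have "Max (t ` A) \<in> t ` A" using fin ne by (intro Max_in) auto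
    then obtain a where "a \<in> A" "t a = Max (t ` A)" by auto
    then show thesis using that[of a] fin by simp
  qed
  show thesis
  proof (rule that[of "inverse (t a)" a])
    show "inverse (t a) > 0" "a /\<^sub>R inverse (t a) \<in> A'" using t a by auto
    show "(*\<^sub>R) (inverse (t a)) ` P \<subseteq> P'"
    proof
      fix y assume "y \<in> (*\<^sub>R) (inverse (t a)) ` P"
      then obtain x where x: "x \<in> P" "y = x /\<^sub>R t a" by blast
      have "b \<bullet> y \<le> 1" if b: "b \<in> A'" for b
      proof -
        obtain s where s: "s > 0" "s *\<^sub>R b \<in> A" using bwd b by blast
        have "(t (s *\<^sub>R b) * s) *\<^sub>R b \<in> A'" using t[OF s(2)] by simp
        then have one: "t (s *\<^sub>R b) * s = 1"
          using facet_system_direction_unique[OF A' b] t[OF s(2)] s(1) by simp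
        then have "b = t (s *\<^sub>R b) *\<^sub>R (s *\<^sub>R b)" by simp
        then have "b \<bullet> x = t (s *\<^sub>R b) * ((s *\<^sub>R b) \<bullet> x)" by (metis inner_scaleR_left)
        also have "\<dots> \<le> t (s *\<^sub>R b) * 1"
          using facet_systemD(2)[OF A, of x] x(1) s(2) t[OF s(2)] by (intro mult_left_mono) auto
        also have "\<dots> \<le> t a" using a(2)[OF s(2)] by simp
        finally show ?thesis using t[OF a(1)] x(2) by (simp add: inverse_eq_divide)
      qed
      then show "y \<in> P'" using facet_systemD(2)[OF A'] by blast
    qed
  qed (use a in auto)
qed

text \<open>
  The boundary of \<open>P\<close> is the union of the facets in hyperplanes shared with \<open>Q\<close> and of the remaining
  ones. These two closed sets are disjoint: the facets of the first kind lie in \<open>Q\<close>, and a hyperplane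
  that supports \<open>P\<close> at a point of \<open>Q \<subseteq> P\<close> supports \<open>Q\<close>, too, hence it is shared if its normal occurs for
  \<open>Q\<close>. Connectedness of the boundary leaves only the facets of the first kind.
\<close>

lemma facet_system_subset_if_common_facets_inside:
  fixes Q P :: "'a::euclidean_space set"
  assumes dim: "DIM('a) \<ge> 2"
    and B: "facet_system B Q" and A: "facet_system A P" and P: "compact P"
    and sub: "Q \<subseteq> P" and meet: "A \<inter> B \<noteq> {}"
    and dir: "\<And>a. a \<in> A \<Longrightarrow> \<exists>t>0. t *\<^sub>R a \<in> B"
    and facets: "\<And>a x. a \<in> A \<inter> B \<Longrightarrow> x \<in> P \<Longrightarrow> a \<bullet> x = 1 \<Longrightarrow> x \<in> Q"
  shows "A \<subseteq> B"
proof -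
  let ?F = "\<lambda>a. {x \<in> P. a \<bullet> x = 1}"
  let ?X = "\<Union>a\<in>A \<inter> B. ?F a" and ?Y = "\<Union>a\<in>A - B. ?F a"
  have fin: "finite A" using facet_systemD(1)[OF A] .
  have clF: "closed (?F a)" for a
  proof -
    have "?F a = P \<inter> {x. a \<bullet> x = 1}" by auto
    then show ?thesis using compact_imp_closed[OF P] by (simp add: closed_Int closed_hyperplane)
  qed
  have clX: "closed ?X" and clY: "closed ?Y" using fin clF by (auto intro!: closed_UN)
  have front: "frontier P = ?X \<union> ?Y"
  proof (intro equalityI subsetI)
    fix x assume x: "x \<in> frontier P"
    then have "x \<in> P" "x \<notin> interior P"
      using compact_imp_closed[OF P] by (auto simp: frontier_def closure_closed)
    then obtain a where "a \<in> A" "\<not> a \<bullet> x < 1" using facet_system_strict_interior[OF A] by blast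
    moreover from this \<open>x \<in> P\<close> have "a \<bullet> x = 1" using facet_systemD(2)[OF A] by force
    ultimately show "x \<in> ?X \<union> ?Y" using \<open>x \<in> P\<close> by blast
  next
    fix x assume "x \<in> ?X \<union> ?Y"
    then obtain a where a: "a \<in> A" "x \<in> P" "a \<bullet> x = 1" by blast
    have "P \<subseteq> {x. a \<bullet> x \<le> 1}" using facet_systemD(2)[OF A] a(1) by blast
    then have "interior P \<subseteq> {x. a \<bullet> x < 1}"
      using interior_mono interior_halfspace_le[OF facet_system_nonzero[OF A a(1)]] by metis
    then show "x \<in> frontier P" using a closure_subset by (auto simp: frontier_def)
  qed
  have disj: "?X \<inter> ?Y = {}"
  proof (rule ccontr)
    assume "?X \<inter> ?Y \<noteq> {}"
    then obtain x a b where x: "x \<in> P" and a: "a \<in> A \<inter> B" "a \<bullet> x = 1" and b: "b \<in> A" "b \<notin> B" "b \<bullet> x = 1" by blast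
    have xQ: "x \<in> Q" using facets[OF a(1) x a(2)] .
    obtain t where t: "t > 0" "t *\<^sub>R b \<in> B" using dir b(1) by blast
    have "(t *\<^sub>R b) \<bullet> x \<le> 1" using facet_systemD(2)[OF B] xQ t(2) by blast
    then have "t \<le> 1" using b(3) by simp
    obtain w where w: "w \<in> Q" "(t *\<^sub>R b) \<bullet> w = 1" using facet_system_witness[OF B t(2)] by blast
    have "b \<bullet> w \<le> 1" using facet_systemD(2)[OF A] sub w(1) b(1) by blast
    then have "t * (b \<bullet> w) \<le> t * 1" using t(1) by (intro mult_left_mono) auto
    then have "t = 1" using w(2) \<open>t \<le> 1\<close> by simp
    then show False using t(2) b(2) by simp
  qed
  have "connected (frontier P)"
  proof -
    have "P = (\<Inter>a\<in>A. {x. a \<bullet> x \<le> 1})" using facet_systemD(2)[OF A] by blast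
    moreover have "convex (\<Inter>a\<in>A. {x. a \<bullet> x \<le> 1})" by (intro convex_INT convex_halfspace_le)
    ultimately have cvx: "convex P" by simp
    have ne: "interior P \<noteq> {}" using facet_system_zero_interior[OF A] by blast
    then have rf: "rel_frontier P = frontier P"
      by (metis affine_hull_nonempty_interior rel_frontier_frontier)
    have "rel_frontier P homeomorphic rel_frontier (cball 0 1 :: 'a set)"
    proof (rule homeomorphic_rel_frontiers_convex_bounded_sets)
      show "aff_dim P = aff_dim (cball 0 1 :: 'a set)"
        using ne by (simp add: aff_dim_nonempty_interior)
    qed (use cvx P compact_imp_bounded in auto)
    moreover have "rel_frontier (cball 0 1 :: 'a set) = sphere 0 1" by (simp add: rel_frontier_cball)
    ultimately have "frontier P homeomorphic (sphere 0 1 :: 'a set)" using rf by simp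
    then show ?thesis using connected_sphere[OF dim] homeomorphic_connectedness by blast
  qed
  then have "?X \<inter> frontier P = {} \<or> ?Y \<inter> frontier P = {}"
    using disj front clX clY by (intro connected_closedD) auto
  moreover have "?X \<inter> frontier P \<noteq> {}"
  proof -
    obtain a where a: "a \<in> A \<inter> B" using meet by blast
    then obtain w where "w \<in> P" "a \<bullet> w = 1" using facet_system_witness[OF A, of a] by blast
    then have "w \<in> ?X" using a by blast
    then show ?thesis unfolding front by blast
  qed
  ultimately have Y: "?Y = {}" unfolding front by blast
  show "A \<subseteq> B"
  proof (rule subsetI, rule ccontr)
    fix a assume a: "a \<in> A" "a \<notin> B"
    obtain w where "w \<in> P" "a \<bullet> w = 1" using facet_system_witness[OF A a(1)] by blast
    then have "w \<in> ?Y" using a by blast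
    then show False unfolding Y by blast
  qed
qed

lemma compact_facet_system_nonempty:
  fixes P :: "'a::euclidean_space set"
  assumes A: "facet_system A P" and P: "compact P"
  shows "A \<noteq> {}"
proof
  assume "A = {}"
  then have "P = UNIV" using facet_systemD(2)[OF A] by blast
  then show False using compact_imp_bounded[OF P] not_bounded_UNIV by simp
qed

text \<open>
  Compare the masses of \<open>c P\<close> and \<open>P'\<close> at the normal of a common facet hyperplane and divide by the
  positive finite mass of \<open>P\<close>, which equals that of \<open>P'\<close>.
\<close>

lemma dilate_inside_power_bound:
  fixes P P' :: "(real ^ 'n) set"
  assumes A: "facet_system A P" and P: "compact P"
    and A': "facet_system A' P'" and P': "compact P'"
    and m: "1 \<le> m" "m \<le> CARD('n)"
    and eq: "\<And>v. norm v = 1 \<Longrightarrow> affine_dual_curvature p m P {v} = affine_dual_curvature p m P' {v}"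
  obtains c a where "c > 0" "a \<in> A" "a /\<^sub>R c \<in> A'" "(*\<^sub>R) c ` P \<subseteq> P'" "c powr (real (m * CARD('n)) - p) \<le> 1"
proof -
  obtain c a where c: "c > 0" and a: "a \<in> A" "a /\<^sub>R c \<in> A'" and sub: "(*\<^sub>R) c ` P \<subseteq> P'"
    using dilate_touching_from_inside[OF A A' compact_facet_system_nonempty[OF A P]
        same_facet_normals[OF A P A' P' m eq] same_facet_normals[OF A' P' A P m eq[symmetric]]] by blast
  have a0: "norm a > 0" using facet_system_nonzero[OF A a(1)] by simp
  have B: "facet_system ((\<lambda>a. a /\<^sub>R c) ` A) ((*\<^sub>R) c ` P)" by (rule facet_system_scale[OF A c])
  have Q: "compact ((*\<^sub>R) c ` P)" using P by (rule compact_scaling)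
  have dir: "(a /\<^sub>R c) /\<^sub>R norm (a /\<^sub>R c) = a /\<^sub>R norm a" using c by simp
  let ?W = "affine_dual_curvature p m P {a /\<^sub>R norm a}"
  have "affine_dual_curvature p m ((*\<^sub>R) c ` P) {a /\<^sub>R norm a} \<le> affine_dual_curvature p m P' {a /\<^sub>R norm a}"
    using affine_dual_curvature_facet_strict_mono(1)[OF B Q A' P' sub a(2) imageI[OF a(1)] m, of p] unfolding dir .
  also have "\<dots> = ?W" using eq[of "a /\<^sub>R norm a"] a0 by simp
  finally have le: "ennreal (c powr (real (m * CARD('n)) - p)) * ?W \<le> ?W"
    unfolding affine_dual_curvature_facet_scale[OF A P a(1) c m] .
  have W: "0 < ?W" "?W < \<infinity>"
    by (rule affine_dual_curvature_facet_pos[OF A P a(1) m], rule affine_dual_curvature_facet_finite[OF A P a(1) m])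
  have "c powr (real (m * CARD('n)) - p) \<le> 1"
  proof -
    let ?s = "c powr (real (m * CARD('n)) - p)"
    obtain r where r: "?W = ennreal r" "r \<ge> 0" using W(2) by (cases ?W) auto
    then have "r > 0" using W(1) by simp
    have "ennreal (?s * r) \<le> ennreal r" using le r by (simp add: ennreal_mult)
    then have "?s * r \<le> r" using r(2) by simp
    then show "?s \<le> 1" using \<open>r > 0\<close> by simp
  qed
  from that[OF c a sub this] show thesis .
qed

lemma supercritical_subset:
  fixes P P' :: "(real ^ 'n) set"
  assumes A: "facet_system A P" and P: "compact P"
    and A': "facet_system A' P'" and P': "compact P'"
    and m: "1 \<le> m" "m \<le> CARD('n)" and p: "p > real (m * CARD('n))"
    and eq: "\<And>v. norm v = 1 \<Longrightarrow> affine_dual_curvature p m P {v} = affine_dual_curvature p m P' {v}"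
  shows "P \<subseteq> P'"
proof -
  obtain c where c: "c > 0" and sub: "(*\<^sub>R) c ` P \<subseteq> P'" and le: "c powr (real (m * CARD('n)) - p) \<le> 1"
    using dilate_inside_power_bound[OF A P A' P' m eq] by metis
  have "c \<ge> 1"
  proof (rule ccontr)
    assume "\<not> c \<ge> 1"
    then have "ln c < 0" using c by simp
    then have "0 < (real (m * CARD('n)) - p) * ln c" using p by (intro mult_neg_neg) simp_all
    then have "1 < c powr (real (m * CARD('n)) - p)" using c by (simp add: powr_def)
    then show False using le by simp
  qed
  have "x \<in> (*\<^sub>R) c ` P" if x: "x \<in> P" for x
  proof -
    have "a \<bullet> x \<le> c" if "a \<in> A" for a using facet_systemD(2)[OF A] x that \<open>c \<ge> 1\<close> by fastforce
    then have "x /\<^sub>R c \<in> P" using facet_systemD(2)[OF A] c by (simp add: inverse_eq_divide)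
    then show ?thesis using c by (auto simp: image_iff intro!: bexI[of _ "x /\<^sub>R c"])
  qed
  then show ?thesis using sub by blast
qed

text \<open>
  In the critical degree the curvature measure is invariant under dilation, so the inscribed dilate
  \<open>c P\<close> has the same masses as \<open>P'\<close>. Strict monotonicity then puts every common facet of \<open>P'\<close> into \<open>c P\<close>.
\<close>

lemma critical_dilate:
  fixes P P' :: "(real ^ 'n) set"
  assumes A: "facet_system A P" and P: "compact P"
    and A': "facet_system A' P'" and P': "compact P'"
    and n: "CARD('n) \<ge> 2" and m: "1 \<le> m" "m \<le> CARD('n)" and p: "p = real (m * CARD('n))"
    and eq: "\<And>v. norm v = 1 \<Longrightarrow> affine_dual_curvature p m P {v} = affine_dual_curvature p m P' {v}"
  shows "\<exists>c>0. P' = (*\<^sub>R) c ` P"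
proof -
  obtain c a where c: "c > 0" and a: "a \<in> A" "a /\<^sub>R c \<in> A'" and sub: "(*\<^sub>R) c ` P \<subseteq> P'"
    using dilate_inside_power_bound[OF A P A' P' m eq] by metis
  let ?Q = "(*\<^sub>R) c ` P" and ?B = "(\<lambda>a. a /\<^sub>R c) ` A"
  have B: "facet_system ?B ?Q" by (rule facet_system_scale[OF A c])
  have Q: "compact ?Q" using P by (rule compact_scaling)
  have "A' \<subseteq> ?B"
  proof (rule facet_system_subset_if_common_facets_inside[OF _ B A' P' sub])
    show "DIM(real ^ 'n) \<ge> 2" using n by simp
    show "A' \<inter> ?B \<noteq> {}" using a by blast
    show "\<exists>t>0. t *\<^sub>R b \<in> ?B" if b: "b \<in> A'" for b
    proof -
      obtain t where "t > 0" "t *\<^sub>R b \<in> A" using same_facet_normals[OF A' P' A P m eq[symmetric] b] by blast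
      then show ?thesis using c by (intro exI[of _ "t / c"]) (auto simp: image_iff divide_inverse mult.commute intro!: bexI[of _ "t *\<^sub>R b"])
    qed
    show "x \<in> ?Q" if b: "b \<in> A' \<inter> ?B" and x: "x \<in> P'" "b \<bullet> x = 1" for b x
    proof (rule ccontr)
      assume xQ: "x \<notin> ?Q"
      obtain d where d: "d \<in> A" "b = d /\<^sub>R c" using b by blast
      have dir: "b /\<^sub>R norm b = d /\<^sub>R norm d" using d(2) c by simp
      have d0: "norm d > 0" using facet_system_nonzero[OF A d(1)] by simp
      have "affine_dual_curvature p m ?Q {d /\<^sub>R norm d} < affine_dual_curvature p m P' {d /\<^sub>R norm d}"
        using affine_dual_curvature_facet_strict_mono(2)[OF B Q A' P' sub _ _ m x xQ, of p] b unfolding dir by blast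
      also have "\<dots> = affine_dual_curvature p m P {d /\<^sub>R norm d}" using eq[of "d /\<^sub>R norm d"] d0 by simp
      also have "\<dots> = affine_dual_curvature p m ?Q {d /\<^sub>R norm d}"
        unfolding affine_dual_curvature_facet_scale[OF A P d(1) c m] using p c by simp
      finally show False by simp
    qed
  qed
  moreover have "?B \<subseteq> A'"
  proof
    fix b assume b: "b \<in> ?B"
    then obtain d where d: "d \<in> A" "b = d /\<^sub>R c" by blast
    obtain t where t: "t > 0" "t *\<^sub>R d \<in> A'" using same_facet_normals[OF A P A' P' m eq d(1)] by blast
    then have "(t * c) *\<^sub>R b \<in> A'" using d(2) c by (simp add: mult.assoc)
    moreover from this have "t * c = 1"
      using \<open>A' \<subseteq> ?B\<close> t(1) c by (intro facet_system_direction_unique[OF B b]) auto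
    ultimately show "b \<in> A'" by simp
  qed
  ultimately have "A' = ?B" by blast
  then have "P' = ?Q" using B A' by (simp add: facet_system_def)
  then show ?thesis using c by blast
qed

theorem theorem4p6:
  fixes P P' :: "(real ^ 'n) set" and m :: nat and p :: real
  assumes "CARD('n) \<ge> 2"
    and "1 \<le> m" and "m \<le> CARD('n) - 1"
    and "polytope P" and "0 \<in> interior P"
    and "polytope P'" and "0 \<in> interior P'"
    and "\<And>\<eta>. \<eta> \<in> sets borel \<Longrightarrow> \<eta> \<subseteq> sphere 0 1 \<Longrightarrow>
           affine_dual_curvature p m P \<eta> = affine_dual_curvature p m P' \<eta>"
  shows "(p > real (m * CARD('n)) \<longrightarrow> P = P') \<and>
         (p = real (m * CARD('n)) \<longrightarrow> (\<exists>c>0. P' = (\<lambda>x. c *\<^sub>R x) ` P))"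
proof -
  obtain A where A: "facet_system A P" using facet_system_exists[OF assms(4,5)] .
  obtain A' where A': "facet_system A' P'" using facet_system_exists[OF assms(6,7)] .
  have P: "compact P" and P': "compact P'"
    using assms(4,6) by (simp_all add: polytope_imp_compact)
  have m: "1 \<le> m" "m \<le> CARD('n)" using assms(2,3) by simp_all
  have eq: "affine_dual_curvature p m P {v} = affine_dual_curvature p m P' {v}" if "norm v = 1" for v
    using that by (intro assms(8)) auto
  show ?thesis
  proof (intro conjI impI)
    assume p: "p > real (m * CARD('n))"
    show "P = P'"
      using supercritical_subset[OF A P A' P' m p eq] supercritical_subset[OF A' P' A P m p eq[symmetric]] by blast
  next
    assume p: "p = real (m * CARD('n))"
    show "\<exists>c>0. P' = (\<lambda>x. c *\<^sub>R x) ` P"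
      by (rule critical_dilate[OF A P A' P' assms(1) m p eq])
  qed
qed

end
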